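(* Let $N\ge1$, $R>0$, $m>1$ with $N>m$, $p>1$, $\gamma\in(0,m-1)$, $\alpha,\beta\in\mathbb R$ with $N+\alpha-m>0$, $\beta-\alpha+1>0$, and $m-1<p<m^*_{\alpha,\beta}-1$ where $m^*_{\alpha,\beta}=\frac{m(N+\beta)}{N+\alpha-m}$. Let $g:[0,\infty)\to[0,\infty)$ be continuous, nondecreasing with $\lim_{v\to\infty}g(v)/v=1$, and let $a:[0,\infty)\to(0,\infty)$ be continuous with $c_1\le a\le c_2$ for constants $0<c_1\le c_2$. For $k\in\mathbb N$ let $g_k(s)=g(\min\{k,s\})$, $s\ge0$. Then for every $k\in\mathbb N$ the problem $$-\Big(\frac{r^{N+\alpha-1}|v'(r)|^{m-2}v'(r)}{(a(r)+g_k(v(r)))^\gamma}\Big)'=r^{N+\beta-1}v^p(r),\ 0<r<R,\qquad v'(0)=0,\ v(R)=0,$$ has a positive solution.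
   Context: A positive solution is a function $v$, positive on $[0,R)$, with $v\in C^1[0,R)\cap C[0,R]$, whose flux $r^{N+\alpha-1}|v'|^{m-2}v'(a+g_k(v))^{-\gamma}$ is $C^1$ on $(0,R)$, satisfying the equation and boundary conditions. *)

theory Defs
  imports "HOL-Analysis.Analysis"
begin

definition flux :: "nat \<Rightarrow> real \<Rightarrow> real \<Rightarrow> real \<Rightarrow> (real \<Rightarrow> real) \<Rightarrow> (real \<Rightarrow> real)
    \<Rightarrow> (real \<Rightarrow> real) \<Rightarrow> (real \<Rightarrow> real) \<Rightarrow> real \<Rightarrow> real" where
  "flux N \<alpha> m \<gamma> a h v v' r =
     r powr (real N + \<alpha> - 1) * \<bar>v' r\<bar> powr (m - 2) * v' r / (a r + h (v r)) powr \<gamma>"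

definition positive_solution ::
  "nat \<Rightarrow> real \<Rightarrow> real \<Rightarrow> real \<Rightarrow> real \<Rightarrow> real \<Rightarrow> (real \<Rightarrow> real) \<Rightarrow> (real \<Rightarrow> real)
   \<Rightarrow> real \<Rightarrow> (real \<Rightarrow> real) \<Rightarrow> bool" where
  "positive_solution N \<alpha> \<beta> m p \<gamma> a h R v \<longleftrightarrow>
     (\<forall>r\<in>{0..<R}. v r > 0) \<and>
     continuous_on {0..R} v \<and> v R = 0 \<and>
     (\<exists>v'. (\<forall>r\<in>{0..<R}. (v has_real_derivative v' r) (at r within {0..<R})) \<and>
           continuous_on {0..<R} v' \<and> v' 0 = 0 \<and>
           (\<exists>F'. (\<forall>r\<in>{0<..<R}.
                    (flux N \<alpha> m \<gamma> a h v v' has_real_derivative F' r) (at r)) \<and>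
                 continuous_on {0<..<R} F' \<and>
                 (\<forall>r\<in>{0<..<R}. - F' r = r powr (real N + \<beta> - 1) * v r powr p)))"

end

theory Submission
  imports Defs "HOL-Complex_Analysis.Great_Picard"
begin

text \<open>
  Integrating the equation once and solving for \<open>v'\<close> gives
  \<open>v' = - c(r, v) (r\<^sup>-\<^sup>\<theta> F(r))\<^sup>q\<close> with \<open>F(r) = \<integral>\<^sub>0\<^sup>r s\<^sup>\<mu> v\<^sup>p ds\<close>, where \<open>\<theta> = N + \<alpha> - 1\<close>,
  \<open>\<mu> = N + \<beta> - 1\<close>, \<open>q = 1 / (m - 1)\<close> and \<open>c = (a + g\<^sub>k(v))\<^sup>\<gamma>\<^sup>q\<close>. One shoots from the origin with
  height \<open>v(0) = d\<close>. Since \<open>c\<close> is merely continuous, initial value problems need not be uniquely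
  solvable; the shooting is therefore done for Tonelli's delayed equation, whose solution is unique
  and continuous in \<open>d\<close>, and the delay is removed at the end by the Arzela-Ascoli theorem.

  For small \<open>d\<close> the delayed solution is positive at \<open>R\<close>, as \<open>p > m - 1\<close>. For large \<open>d\<close> every solution
  is negative at \<open>R\<close>, so that for small delays the delayed one is negative as well. This is a Pohozaev
  argument on an interval \<open>[0, r\<^sub>1]\<close> with \<open>v(r\<^sub>1) = K\<close>, where \<open>K\<close> does not depend on \<open>d\<close> and \<open>v \<ge> K \<ge> k\<close>,
  so that \<open>g\<^sub>k(v)\<close> is constant there: if \<open>v(R) \<ge> 0\<close>, the Pohozaev energy at \<open>r\<^sub>1\<close> is bounded
  independently of \<open>d\<close>, while subcriticality makes the energy increase by an amount tending to
  infinity with \<open>d\<close>.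
\<close>

subsection \<open>The integrated equation\<close>

text \<open>Of \<open>g\<close> and \<open>a\<close> only the continuity and the two-sided bounds of
  the combined coefficient \<open>c\<close> are kept. For the original data \<open>theta\<close>
  reads N + \<alpha> - m > 0 and \<open>mu\<close> reads \<beta> - \<alpha> + 1 > 0. Subcriticality
  and constancy of \<open>c\<close> for large \<open>s\<close> are assumed later, where large
  heights are treated.\<close>

locale radial_flow =
  fixes m p \<theta> \<mu> R cl cu :: real and c :: "real \<Rightarrow> real \<Rightarrow> real"
  assumes m: "1 < m" and theta: "m < \<theta> + 1" and mu: "\<theta> < \<mu> + 1" and p: "m - 1 < p"
    and R: "0 < R" and cl: "0 < cl"
    and c_cont: "continuous_on ({0..R} \<times> {0..}) (\<lambda>(r, s). c r s)"
    and c_bounds: "\<And>r s. r \<in> {0..R} \<Longrightarrow> 0 \<le> s \<Longrightarrow> cl \<le> c r s \<and> c r s \<le> cu"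
begin

definition q :: real where "q = 1 / (m - 1)"

text \<open>The cutoff \<open>max 0\<close> keeps the nonlinearity defined after a profile has
  become negative, so that every shot reaches \<open>R\<close> and its sign there can be
  used.\<close>

definition mass :: "(real \<Rightarrow> real) \<Rightarrow> real \<Rightarrow> real" where
  "mass u r = integral {0..r} (\<lambda>s. s powr \<mu> * max 0 (u s) powr p)"

definition slope :: "(real \<Rightarrow> real) \<Rightarrow> real \<Rightarrow> real" where
  "slope u r = c r (max 0 (u r)) * (r powr (-\<theta>) * mass u r) powr q"

lemma q_pos: "0 < q" and q_m: "q * (m - 1) = 1"
  using m by (auto simp: q_def)

lemma p_pos: "0 < p" and theta_pos: "0 < \<theta>" and mu_pos: "0 < \<mu> + 1"
  using m theta mu p by auto

lemma pq: "1 < p * q"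
  using p m by (simp add: q_def)

lemma cu: "0 < cu"
  using c_bounds[of 0 0] cl R by simp

section \<open>Integrability, bounds and limits of the weighted mass\<close>

lemma absolutely_integrable_mass:
  assumes "continuous_on {0..R} u" "r \<le> R"
  shows "(\<lambda>s. s powr \<mu> * max 0 (u s) powr p) absolutely_integrable_on {0..r}"
proof -
  have cont: "continuous_on {0..r} (\<lambda>s. max 0 (u s) powr p)"
    using p_pos assms(2)
    by (intro continuous_on_powr' continuous_intros continuous_on_subset[OF assms(1)]) auto
  \<comment> \<open>Since \<mu> may be negative, the weight can be singular at the origin; the
    integrand is therefore split into a bounded measurable factor and an absolutely integrable
    one.\<close>
  have "(\<lambda>s. s powr \<mu>) absolutely_integrable_on {0..r}"
  proof (cases "0 \<le> r")
    case True
    have "(\<lambda>s. s powr \<mu>) integrable_on {0..r}"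
      using has_integral_powr_from_0[of \<mu> r] mu_pos True by (auto simp: integrable_on_def)
    then show ?thesis
      by (intro nonnegative_absolutely_integrable_1) auto
  qed auto
  then have "(\<lambda>s. max 0 (u s) powr p * s powr \<mu>) absolutely_integrable_on {0..r}"
    using cont
    by (intro absolutely_integrable_bounded_measurable_product_real
        continuous_imp_measurable_on_sets_lebesgue compact_imp_bounded compact_continuous_image) auto
  then show ?thesis
    by (simp add: mult.commute)
qed

lemma integrable_mass:
  assumes "continuous_on {0..R} u" "r \<le> R"
  shows "(\<lambda>s. s powr \<mu> * max 0 (u s) powr p) integrable_on {0..r}"
  using absolutely_integrable_mass[OF assms] set_lebesgue_integral_eq_integral(1) by blast

lemma mass_0 [simp]: "mass u 0 = 0"
  by (simp add: mass_def)

lemma mass_nonneg: "0 \<le> mass u r"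
proof (cases "(\<lambda>s. s powr \<mu> * max 0 (u s) powr p) integrable_on {0..r}")
  case True
  then show ?thesis
    unfolding mass_def by (intro Henstock_Kurzweil_Integration.integral_nonneg) auto
qed (simp add: mass_def not_integrable_integral)

lemma mass_mono:
  assumes "continuous_on {0..R} u" "r \<le> s" "s \<le> R"
  shows "mass u r \<le> mass u s"
  unfolding mass_def using assms
  by (intro integral_subset_le integrable_mass) auto

lemma mass_le:
  assumes "continuous_on {0..R} u" "0 \<le> r" "r \<le> R" "0 \<le> M" "\<And>s. s \<in> {0..r} \<Longrightarrow> u s \<le> M"
  shows "mass u r \<le> M powr p * r powr (\<mu> + 1) / (\<mu> + 1)"
proof -
  have I: "((\<lambda>s. s powr \<mu> * M powr p) has_integral r powr (\<mu> + 1) / (\<mu> + 1) * M powr p) {0..r}"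
    using has_integral_powr_from_0[of \<mu> r] mu_pos assms(2) by (intro has_integral_mult_left) auto
  have "mass u r \<le> integral {0..r} (\<lambda>s. s powr \<mu> * M powr p)"
    unfolding mass_def using assms I p_pos
    by (intro integral_le integrable_mass mult_left_mono powr_mono2) auto
  then show ?thesis
    using integral_unique[OF I] by (simp add: mult.commute)
qed

lemma mass_ge:
  assumes "continuous_on {0..R} u" "0 \<le> r" "r \<le> R" "0 \<le> M" "\<And>s. s \<in> {0..r} \<Longrightarrow> M \<le> u s"
  shows "M powr p * r powr (\<mu> + 1) / (\<mu> + 1) \<le> mass u r"
proof -
  have I: "((\<lambda>s. s powr \<mu> * M powr p) has_integral r powr (\<mu> + 1) / (\<mu> + 1) * M powr p) {0..r}"
    using has_integral_powr_from_0[of \<mu> r] mu_pos assms(2) by (intro has_integral_mult_left) auto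
  have "integral {0..r} (\<lambda>s. s powr \<mu> * M powr p) \<le> mass u r"
    unfolding mass_def using assms I p_pos
    by (intro integral_le integrable_mass mult_left_mono powr_mono2) (auto simp: le_max_iff_disj)
  then show ?thesis
    using integral_unique[OF I] by (simp add: mult.commute)
qed

lemma continuous_on_mass:
  assumes "continuous_on {0..R} u"
  shows "continuous_on {0..R} (mass u)"
  unfolding mass_def using integrable_mass[OF assms order_refl]
  by (rule indefinite_integral_continuous_1)

lemma has_real_derivative_mass:
  assumes u: "continuous_on {0..R} u" and r: "0 < r" "r < R"
  shows "(mass u has_real_derivative r powr \<mu> * max 0 (u r) powr p) (at r)"
proof -
  define f where "f = (\<lambda>s. s powr \<mu> * max 0 (u s) powr p)"
  \<comment> \<open>The fundamental theorem of calculus is applied away from the possible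
    singularity at 0; the constant integral over \<open>{0..r/2}\<close> is added
    afterwards.\<close>
  have "continuous_on {r/2..R} f"
    unfolding f_def using p_pos r
    by (intro continuous_intros continuous_on_powr' continuous_on_subset[OF u]) auto
  then have "((\<lambda>x. integral {r/2..x} f) has_real_derivative f r) (at r within {r/2..R})"
    using r by (intro integral_has_real_derivative) auto
  then have "((\<lambda>x. integral {r/2..x} f) has_real_derivative f r) (at r)"
    using r at_within_Icc_at[of "r/2" r R] by simp
  then have *: "((\<lambda>x. integral {0..r/2} f + integral {r/2..x} f) has_real_derivative f r) (at r)"
    by (auto intro!: derivative_eq_intros)
  have "\<forall>\<^sub>F x in nhds r. x \<in> {r/2<..<R}"
    using r by (intro eventually_nhds_in_open) auto
  then have "\<forall>\<^sub>F x in nhds r. integral {0..r/2} f + integral {r/2..x} f = mass u x"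
  proof eventually_elim
    case (elim x)
    then show ?case
      unfolding mass_def f_def using r
      by (intro Henstock_Kurzweil_Integration.integral_combine integrable_mass[OF u]) auto
  qed
  then show ?thesis
    using * DERIV_cong_ev[OF refl _ refl] by (force simp: f_def)
qed

lemma tendsto_mass:
  assumes u: "\<And>n. continuous_on {0..R} (u n)" and w: "continuous_on {0..R} w" and r: "r \<in> {0..R}"
    and le: "\<And>n s. s \<in> {0..R} \<Longrightarrow> u n s \<le> M"
    and lim: "\<And>s. s \<in> {0..R} \<Longrightarrow> (\<lambda>n. u n s) \<longlonglongrightarrow> w s"
  shows "(\<lambda>n. mass (u n) r) \<longlonglongrightarrow> mass w r"
  unfolding mass_def
proof (rule dominated_convergence(2))
  show "(\<lambda>s. s powr \<mu> * max 0 (u n s) powr p) integrable_on {0..r}" for n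
    using u r by (intro integrable_mass) auto
  show "(\<lambda>s. s powr \<mu> * max 0 M powr p) integrable_on {0..r}"
    using has_integral_powr_from_0[of \<mu> r] mu_pos r
    by (intro integrable_on_mult_left) (auto simp: integrable_on_def)
  show "norm (s powr \<mu> * max 0 (u n s) powr p) \<le> s powr \<mu> * max 0 M powr p" if "s \<in> {0..r}" for n s
  proof -
    have "u n s \<le> M"
      using le that r by auto
    then show ?thesis
      using p_pos by (auto simp: abs_mult intro!: mult_left_mono powr_mono2)
  qed
  show "(\<lambda>n. s powr \<mu> * max 0 (u n s) powr p) \<longlonglongrightarrow> s powr \<mu> * max 0 (w s) powr p" if "s \<in> {0..r}" for s
    using lim[of s] that r p_pos by (intro tendsto_intros tendsto_powr') auto
qed

text \<open>Only the origin is critical. There an upper bound for \<open>u\<close> makes the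
  quotient at most a multiple of \<open>r powr (\<mu> + 1 - \<theta>)\<close>, whose exponent is
  positive by \<open>mu\<close>. This is what makes the derivative of a solution tend to 0 at the
  origin.\<close>

lemma continuous_on_mass_quotient:
  assumes u: "continuous_on {0..R} u"
  shows "continuous_on {0..R} (\<lambda>r. r powr (-\<theta>) * mass u r)"
proof -
  obtain M where M: "0 \<le> M" "\<And>s. s \<in> {0..R} \<Longrightarrow> u s \<le> M"
  proof -
    have "bounded (u ` {0..R})"
      using u by (intro compact_imp_bounded compact_continuous_image) auto
    then obtain M where "\<forall>x\<in>u ` {0..R}. norm x \<le> M"
      by (auto simp: bounded_iff)
    then show ?thesis
      using that[of "max 0 M"] by force
  qed
  show ?thesis
    unfolding continuous_on_eq_continuous_within
  proof
    fix r assume r: "r \<in> {0..R}"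
    show "continuous (at r within {0..R}) (\<lambda>r. r powr (-\<theta>) * mass u r)"
    proof (cases "r = 0")
      case False
      then show ?thesis
        using r continuous_on_mass[OF u]
        by (auto intro!: tendsto_intros simp: continuous_on_def continuous_within)
    next
      case True
      have "((\<lambda>r. M powr p * r powr (\<mu> + 1 - \<theta>) / (\<mu> + 1)) \<longlongrightarrow>
              M powr p * 0 powr (\<mu> + 1 - \<theta>) / (\<mu> + 1)) (at 0 within {0..R})"
        using mu mu_pos by (intro tendsto_intros tendsto_powr') (auto simp: eventually_at_filter)
      then have L: "((\<lambda>r. M powr p * r powr (\<mu> + 1 - \<theta>) / (\<mu> + 1)) \<longlongrightarrow> 0) (at 0 within {0..R})"
        by simp
      have "((\<lambda>r. r powr (-\<theta>) * mass u r) \<longlongrightarrow> 0) (at 0 within {0..R})"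
      proof (rule tendsto_sandwich[OF _ _ tendsto_const L])
        show "\<forall>\<^sub>F r in at 0 within {0..R}. 0 \<le> r powr - \<theta> * mass u r"
          by (simp add: mass_nonneg)
        show "\<forall>\<^sub>F r in at 0 within {0..R}. r powr - \<theta> * mass u r \<le> M powr p * r powr (\<mu> + 1 - \<theta>) / (\<mu> + 1)"
          unfolding eventually_at_filter
        proof (intro always_eventually allI impI)
          fix s assume s: "s \<noteq> 0" "s \<in> {0..R}"
          have "s powr - \<theta> * mass u s \<le> s powr - \<theta> * (M powr p * s powr (\<mu> + 1) / (\<mu> + 1))"
            using s M by (intro mult_left_mono mass_le[OF u]) auto
          also have "\<dots> = M powr p * s powr (\<mu> + 1 - \<theta>) / (\<mu> + 1)"
            using s by (simp add: powr_diff powr_minus field_simps)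
          finally show "s powr - \<theta> * mass u s \<le> M powr p * s powr (\<mu> + 1 - \<theta>) / (\<mu> + 1)" .
        qed
      qed
      then show ?thesis
        using True by (simp add: continuous_within)
    qed
  qed
qed

section \<open>Continuity, bounds and limits of the slope\<close>

lemma continuous_on_slope:
  assumes u: "continuous_on {0..R} u"
  shows "continuous_on {0..R} (slope u)"
proof -
  have "continuous_on {0..R} (\<lambda>r. (\<lambda>(r, s). c r s) (r, max 0 (u r)))"
    using u by (intro continuous_on_compose2[OF c_cont] continuous_intros) auto
  then have "continuous_on {0..R} (\<lambda>r. c r (max 0 (u r)))"
    by simp
  moreover have "continuous_on {0..R} (\<lambda>r. (r powr (-\<theta>) * mass u r) powr q)"
    using q_pos by (intro continuous_on_powr'[OF continuous_on_mass_quotient[OF u] continuous_on_const])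
      (auto simp: mass_nonneg)
  ultimately show ?thesis
    unfolding slope_def by (rule continuous_on_mult)
qed

lemma slope_nonneg: "r \<in> {0..R} \<Longrightarrow> 0 \<le> slope u r"
  using c_bounds[of r "max 0 (u r)"] cl by (simp add: slope_def)

lemma slope_le:
  assumes "continuous_on {0..R} u" "0 \<le> r" "r \<le> R" "0 \<le> M" "\<And>s. s \<in> {0..r} \<Longrightarrow> u s \<le> M"
  shows "slope u r \<le> cu * (r powr (\<mu> + 1 - \<theta>) * M powr p / (\<mu> + 1)) powr q"
proof -
  have "r powr (-\<theta>) * mass u r \<le> r powr (-\<theta>) * (M powr p * r powr (\<mu> + 1) / (\<mu> + 1))"
    using assms by (intro mult_left_mono mass_le) auto
  also have "\<dots> = r powr (\<mu> + 1 - \<theta>) * M powr p / (\<mu> + 1)"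
    by (cases "r = 0") (simp_all add: powr_diff powr_minus field_simps)
  finally have "(r powr (-\<theta>) * mass u r) powr q \<le> (r powr (\<mu> + 1 - \<theta>) * M powr p / (\<mu> + 1)) powr q"
    using q_pos mass_nonneg by (intro powr_mono2) auto
  then show ?thesis
    unfolding slope_def using c_bounds[of r "max 0 (u r)"] cl cu assms
    by (intro mult_mono) auto
qed

text \<open>Independent of \<open>r\<close> and \<open>u\<close>, this serves as a common Lipschitz
  constant for all delayed solutions of height at most \<open>M\<close>.\<close>

definition slope_bound :: "real \<Rightarrow> real" where
  "slope_bound M = cu * (R powr (\<mu> + 1 - \<theta>) * M powr p / (\<mu> + 1)) powr q"

lemma slope_le_bound:
  assumes "continuous_on {0..R} u" "r \<in> {0..R}" "0 \<le> M" "\<And>s. s \<in> {0..R} \<Longrightarrow> u s \<le> M"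
  shows "slope u r \<le> slope_bound M"
proof -
  have "slope u r \<le> cu * (r powr (\<mu> + 1 - \<theta>) * M powr p / (\<mu> + 1)) powr q"
    using assms by (intro slope_le) auto
  also have "\<dots> \<le> slope_bound M"
    unfolding slope_bound_def using assms cu q_pos mu mu_pos
    by (intro mult_left_mono powr_mono2 divide_right_mono mult_right_mono) auto
  finally show ?thesis .
qed

lemma slope_bound_nonneg: "0 \<le> slope_bound M"
  using cu by (simp add: slope_bound_def)

lemma tendsto_slope:
  assumes u: "\<And>n. continuous_on {0..R} (u n)" and w: "continuous_on {0..R} w" and r: "r \<in> {0..R}"
    and le: "\<And>n s. s \<in> {0..R} \<Longrightarrow> u n s \<le> M"
    and lim: "\<And>s. s \<in> {0..R} \<Longrightarrow> (\<lambda>n. u n s) \<longlonglongrightarrow> w s"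
  shows "(\<lambda>n. slope (u n) r) \<longlonglongrightarrow> slope w r"
proof -
  have c: "continuous (at (r, max 0 (w r)) within {0..R} \<times> {0..}) (\<lambda>(r, s). c r s)"
    using c_cont r by (auto simp: continuous_on_eq_continuous_within)
  have "(\<lambda>n. (r, max 0 (u n r))) \<longlonglongrightarrow> (r, max 0 (w r))"
    using lim r by (intro tendsto_intros) auto
  from continuous_within_tendsto_compose'[OF c _ this]
  have "(\<lambda>n. c r (max 0 (u n r))) \<longlonglongrightarrow> c r (max 0 (w r))"
    using r by simp
  moreover have "(\<lambda>n. (r powr (-\<theta>) * mass (u n) r) powr q) \<longlonglongrightarrow> (r powr (-\<theta>) * mass w r) powr q"
    using q_pos by (intro tendsto_intros tendsto_powr' tendsto_mass[OF u w r le lim])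
      (auto simp: mass_nonneg)
  ultimately show ?thesis
    unfolding slope_def by (intro tendsto_mult)
qed

text \<open>Dominated convergence handles the integrand, and moving the endpoint costs at most
  \<open>C * \<bar>x n - y\<bar>\<close>. The lemma yields both continuity in the height, where the
  endpoint is fixed, and removal of the delay, where it moves.\<close>

lemma tendsto_integral_slope:
  assumes u: "\<And>n. continuous_on {0..R} (u n)" and w: "continuous_on {0..R} w"
    and x: "\<And>n. x n \<in> {0..R}" "x \<longlonglongrightarrow> y"
    and le: "\<And>n s. s \<in> {0..R} \<Longrightarrow> u n s \<le> M"
    and lim: "\<And>s. s \<in> {0..R} \<Longrightarrow> (\<lambda>n. u n s) \<longlonglongrightarrow> w s"
  shows "(\<lambda>n. integral {0..x n} (slope (u n))) \<longlonglongrightarrow> integral {0..y} (slope w)"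
proof -
  define C where "C = slope_bound (max 0 M)"
  have y: "y \<in> {0..R}"
    using x by (meson closed_atLeastAtMost closed_sequentially)
  have int: "slope v integrable_on {a..b}" if "continuous_on {0..R} v" "0 \<le> a" "b \<le> R" for v a b
    using that by (intro integrable_continuous_real continuous_on_subset[OF continuous_on_slope]) auto
  have C: "norm (slope (u n) s) \<le> C" if "s \<in> {0..R}" for n s
  proof -
    have "slope (u n) s \<le> C"
      unfolding C_def using le by (intro slope_le_bound[OF u that]) (auto simp: le_max_iff_disj)
    then show ?thesis
      using slope_nonneg[OF that, of "u n"] by simp
  qed
  have 1: "(\<lambda>n. integral {0..y} (slope (u n))) \<longlonglongrightarrow> integral {0..y} (slope w)"
  proof (rule dominated_convergence(2)[where h="\<lambda>_. C"])
    show "(\<lambda>n. slope (u n) s) \<longlonglongrightarrow> slope w s" if "s \<in> {0..y}" for s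
      using that y by (intro tendsto_slope[OF u w _ le lim]) auto
  qed (use y int[OF u] C in auto)
  have close: "norm (integral {0..x n} (slope (u n)) - integral {0..y} (slope (u n))) \<le> C * \<bar>x n - y\<bar>" for n
  proof (cases "x n \<le> y")
    case True
    have "integral {0..x n} (slope (u n)) + integral {x n..y} (slope (u n)) = integral {0..y} (slope (u n))"
      using True x(1)[of n] y int[OF u] by (intro Henstock_Kurzweil_Integration.integral_combine) auto
    moreover have "norm (integral {x n..y} (slope (u n))) \<le> C * (y - x n)"
      using True x(1)[of n] y C int[OF u]
      by (intro integral_bound continuous_on_subset[OF continuous_on_slope[OF u]]) auto
    ultimately show ?thesis
      using True by (simp add: abs_if split: if_splits)
  next
    case False
    have "integral {0..y} (slope (u n)) + integral {y..x n} (slope (u n)) = integral {0..x n} (slope (u n))"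
      using False x(1)[of n] y int[OF u] by (intro Henstock_Kurzweil_Integration.integral_combine) auto
    moreover have "norm (integral {y..x n} (slope (u n))) \<le> C * (x n - y)"
      using False x(1)[of n] y C int[OF u]
      by (intro integral_bound continuous_on_subset[OF continuous_on_slope[OF u]]) auto
    ultimately show ?thesis
      using False by (simp add: abs_if split: if_splits)
  qed
  have null: "(\<lambda>n. C * \<bar>x n - y\<bar>) \<longlonglongrightarrow> 0"
    using tendsto_mult[OF tendsto_const tendsto_rabs[OF tendsto_diff[OF x(2) tendsto_const]], of C y] by simp
  have 2: "(\<lambda>n. integral {0..x n} (slope (u n)) - integral {0..y} (slope (u n))) \<longlonglongrightarrow> 0"
    by (rule Lim_null_comparison[OF _ null]) (simp only: close eventually_True)
  show ?thesis
    using tendsto_add[OF 2 1] by simp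
qed

subsection \<open>The delayed equation\<close>

text \<open>The maximum freezes the value at \<open>d\<close> on \<open>{0..\<epsilon>}\<close>;
  \<open>\<epsilon> = 0\<close> gives the integrated equation itself.\<close>

definition delayed :: "real \<Rightarrow> real \<Rightarrow> (real \<Rightarrow> real) \<Rightarrow> real \<Rightarrow> real" where
  "delayed \<epsilon> d u r = d - integral {0..max 0 (r - \<epsilon>)} (slope u)"

lemma slope_integrable:
  assumes "continuous_on {0..R} u" "0 \<le> a" "b \<le> R"
  shows "slope u integrable_on {a..b}"
  using assms by (intro integrable_continuous_real continuous_on_subset[OF continuous_on_slope]) auto

lemma delayed_diff:
  assumes u: "continuous_on {0..R} u" and r: "0 \<le> r" "r \<le> s" "s \<le> R" and \<epsilon>: "0 \<le> \<epsilon>"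
  shows "delayed \<epsilon> d u r - delayed \<epsilon> d u s = integral {max 0 (r - \<epsilon>)..max 0 (s - \<epsilon>)} (slope u)"
proof -
  have "integral {0..max 0 (r - \<epsilon>)} (slope u) + integral {max 0 (r - \<epsilon>)..max 0 (s - \<epsilon>)} (slope u)
      = integral {0..max 0 (s - \<epsilon>)} (slope u)"
    using r \<epsilon> by (intro Henstock_Kurzweil_Integration.integral_combine slope_integrable[OF u]) auto
  then show ?thesis
    by (simp add: delayed_def)
qed

lemma delayed_antimono:
  assumes u: "continuous_on {0..R} u" and r: "0 \<le> r" "r \<le> s" "s \<le> R" and \<epsilon>: "0 \<le> \<epsilon>"
  shows "delayed \<epsilon> d u s \<le> delayed \<epsilon> d u r"
proof -
  have "0 \<le> integral {max 0 (r - \<epsilon>)..max 0 (s - \<epsilon>)} (slope u)"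
    using r \<epsilon> by (intro Henstock_Kurzweil_Integration.integral_nonneg slope_integrable[OF u])
      (auto intro!: slope_nonneg)
  then show ?thesis
    using delayed_diff[OF assms, of d] by simp
qed

lemma delayed_0 [simp]: "0 \<le> \<epsilon> \<Longrightarrow> delayed \<epsilon> d u 0 = d"
  by (simp add: delayed_def max_def)

lemma delayed_le:
  assumes "continuous_on {0..R} u" "r \<in> {0..R}" "0 \<le> \<epsilon>"
  shows "delayed \<epsilon> d u r \<le> d"
  using delayed_antimono[of u 0 r \<epsilon> d] assms by simp

lemma delayed_diff_le:
  assumes u: "continuous_on {0..R} u" and r: "0 \<le> r" "r \<le> s" "s \<le> R" and \<epsilon>: "0 \<le> \<epsilon>"
    and M: "0 \<le> M" "\<And>x. x \<in> {0..R} \<Longrightarrow> u x \<le> M"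
  shows "delayed \<epsilon> d u r - delayed \<epsilon> d u s \<le> slope_bound M * (s - r)"
proof -
  have "norm (integral {max 0 (r - \<epsilon>)..max 0 (s - \<epsilon>)} (slope u))
      \<le> slope_bound M * (max 0 (s - \<epsilon>) - max 0 (r - \<epsilon>))"
  proof (rule integral_bound)
    show "continuous_on {max 0 (r - \<epsilon>)..max 0 (s - \<epsilon>)} (slope u)"
      using r \<epsilon> by (intro continuous_on_subset[OF continuous_on_slope[OF u]]) auto
    show "norm (slope u t) \<le> slope_bound M" if "t \<in> {max 0 (r - \<epsilon>)..max 0 (s - \<epsilon>)}" for t
    proof -
      have "t \<in> {0..R}"
        using that r \<epsilon> by auto
      then show ?thesis
        using slope_nonneg[of t u] slope_le_bound[OF u _ M] by simp
    qed
  qed (use r in auto)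
  also have "\<dots> \<le> slope_bound M * (s - r)"
    using r slope_bound_nonneg by (intro mult_left_mono) auto
  finally show ?thesis
    using delayed_diff[OF u r \<epsilon>, of d] by simp
qed

lemma continuous_on_delayed:
  assumes u: "continuous_on {0..R} u" and \<epsilon>: "0 \<le> \<epsilon>"
  shows "continuous_on {0..R} (delayed \<epsilon> d u)"
proof -
  have "continuous_on {0..R} (\<lambda>x. integral {0..x} (slope u))"
    by (intro indefinite_integral_continuous_1 slope_integrable[OF u]) auto
  then show ?thesis
    unfolding delayed_def using \<epsilon>
    by (intro continuous_intros) (auto elim!: continuous_on_compose2 intro!: continuous_intros)
qed

section \<open>Tonelli's scheme and its dependence on the height\<close>

primrec iterate :: "real \<Rightarrow> real \<Rightarrow> nat \<Rightarrow> real \<Rightarrow> real" where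
  "iterate \<epsilon> d 0 = (\<lambda>_. d)"
| "iterate \<epsilon> d (Suc n) = delayed \<epsilon> d (iterate \<epsilon> d n)"

lemma continuous_on_iterate: "0 \<le> \<epsilon> \<Longrightarrow> continuous_on {0..R} (iterate \<epsilon> d n)"
  by (induction n) (auto intro: continuous_on_delayed)

lemma iterate_le: "0 \<le> \<epsilon> \<Longrightarrow> r \<in> {0..R} \<Longrightarrow> iterate \<epsilon> d n r \<le> d"
  by (cases n) (auto intro: delayed_le continuous_on_iterate)

lemma slope_cong:
  assumes "\<And>s. s \<in> {0..r} \<Longrightarrow> u s = w s" "0 \<le> r"
  shows "slope u r = slope w r"
proof -
  have "mass u r = mass w r"
    unfolding mass_def using assms by (intro integral_cong) auto
  then show ?thesis
    using assms by (simp add: slope_def)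
qed

text \<open>The right-hand side at \<open>r\<close> sees its argument only on
  \<open>{0..r - \<epsilon>}\<close>, so each iteration settles the values on one more interval of
  length \<open>\<epsilon>\<close>.\<close>

lemma iterate_stable:
  assumes "0 \<le> \<epsilon>" "0 \<le> r" "r \<le> real n * \<epsilon>"
  shows "iterate \<epsilon> d (Suc n) r = iterate \<epsilon> d n r"
  using assms(2-)
proof (induction n arbitrary: r)
  case (Suc n)
  have "integral {0..max 0 (r - \<epsilon>)} (slope (iterate \<epsilon> d (Suc n)))
      = integral {0..max 0 (r - \<epsilon>)} (slope (iterate \<epsilon> d n))"
  proof (intro integral_cong slope_cong)
    fix x s assume x: "x \<in> {0..max 0 (r - \<epsilon>)}" "s \<in> {0..x}"
    have "max 0 (r - \<epsilon>) \<le> real n * \<epsilon>"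
      using Suc.prems assms(1) by (intro max.boundedI) (auto simp: algebra_simps)
    then have "s \<le> real n * \<epsilon>"
      using x unfolding atLeastAtMost_iff by linarith
    then show "iterate \<epsilon> d (Suc n) s = iterate \<epsilon> d n s"
      using x by (intro Suc.IH) auto
  qed auto
  then show ?case
    by (simp add: delayed_def)
qed (use assms in \<open>simp add: delayed_def\<close>)

definition profile :: "real \<Rightarrow> (real \<Rightarrow> real) \<Rightarrow> bool" where
  "profile D u \<longleftrightarrow> continuous_on {0..R} u \<and> (\<forall>r\<in>{0..R}. u r = delayed 0 D u r)"

text \<open>With delay \<open>R / Suc n\<close>, exactly \<open>Suc n\<close> iterations settle the
  whole interval \<open>{0..R}\<close>, so this iterate solves the delayed equation exactly.\<close>

definition tonelli :: "nat \<Rightarrow> real \<Rightarrow> real \<Rightarrow> real" where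
  "tonelli n d = iterate (R / Suc n) d (Suc n)"

lemma continuous_on_tonelli: "continuous_on {0..R} (tonelli n d)"
  unfolding tonelli_def using R by (intro continuous_on_iterate) auto

lemma tonelli_fixed:
  assumes "r \<in> {0..R}"
  shows "tonelli n d r = delayed (R / Suc n) d (tonelli n d) r"
  using iterate_stable[of "R / Suc n" r "Suc n" d] assms R
  by (simp add: tonelli_def del: of_nat_Suc)

text \<open>Each step is an explicit continuous functional of the preceding one, so convergence of
  the heights passes through finitely many steps; boundedness of the heights supplies the dominating
  constant.\<close>

lemma iterate_tendsto:
  assumes "0 \<le> \<epsilon>" and d: "d \<longlonglongrightarrow> d'" and "r \<in> {0..R}"
  shows "(\<lambda>i. iterate \<epsilon> (d i) n r) \<longlonglongrightarrow> iterate \<epsilon> d' n r"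
  using assms(3)
proof (induction n arbitrary: r)
  case (Suc n)
  obtain M where M: "\<And>i. d i \<le> M"
  proof -
    have "bounded (range d)"
      using d convergent_imp_bounded by blast
    then obtain M where "\<And>i. \<bar>d i\<bar> \<le> M"
      by (auto simp: bounded_iff)
    then show ?thesis
      using that abs_le_D1 by blast
  qed
  have "(\<lambda>i. integral {0..max 0 (r - \<epsilon>)} (slope (iterate \<epsilon> (d i) n)))
      \<longlonglongrightarrow> integral {0..max 0 (r - \<epsilon>)} (slope (iterate \<epsilon> d' n))"
  proof (rule tendsto_integral_slope)
    show "iterate \<epsilon> (d i) n s \<le> M" if "s \<in> {0..R}" for i s
      using iterate_le[OF assms(1) that, of "d i" n] M[of i] by simp
  qed (use Suc assms(1) continuous_on_iterate in auto)
  then show ?case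
    using d by (auto simp: delayed_def intro!: tendsto_intros)
qed (use d in simp)

lemma continuous_on_tonelli_height: "continuous_on S (\<lambda>d. tonelli n d R)"
  unfolding continuous_on_sequentially tonelli_def
  using R by (auto intro!: iterate_tendsto simp: o_def simp del: iterate.simps)

text \<open>The Lipschitz constant \<open>slope_bound D\<close> does not depend on the delay, so
  Arzela-Ascoli gives a uniformly convergent subsequence, and the vanishing delays turn the limit
  into a profile. The general \<open>j\<close> permits use along a subsequence already extracted;
  the closed range of heights keeps the limit height at least \<open>\<delta>\<close>.\<close>

lemma tonelli_compactness:
  assumes j: "strict_mono (j :: nat \<Rightarrow> nat)" and d: "\<And>n. d n \<in> {\<delta>..D}" and D: "0 \<le> D"
  obtains u k d' where "strict_mono (k :: nat \<Rightarrow> nat)" "d' \<in> {\<delta>..D}" "profile d' u"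
    "\<And>r. r \<in> {0..R} \<Longrightarrow> (\<lambda>i. tonelli (j (k i)) (d (k i)) r) \<longlonglongrightarrow> u r"
proof -
  define w where "w n = tonelli (j n) (d n)" for n
  define \<epsilon> where "\<epsilon> n = R / Suc (j n)" for n
  have \<epsilon>: "0 \<le> \<epsilon> n" for n
    using R by (simp add: \<epsilon>_def)
  have w_cont: "continuous_on {0..R} (w n)" for n
    unfolding w_def by (rule continuous_on_tonelli)
  have w_eq: "w n r = delayed (\<epsilon> n) (d n) (w n) r" if "r \<in> {0..R}" for n r
    using tonelli_fixed[OF that] by (simp add: w_def \<epsilon>_def)
  have w_le: "w n r \<le> D" if "r \<in> {0..R}" for n r
  proof -
    have "delayed (\<epsilon> n) (d n) (w n) r \<le> d n"
      by (rule delayed_le[OF w_cont that \<epsilon>])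
    then show ?thesis
      using w_eq[OF that, of n] d[of n] by simp
  qed
  define L where "L = slope_bound D"
  have lip': "\<bar>w n r - w n s\<bar> \<le> L * \<bar>r - s\<bar>" if "r \<in> {0..R}" "s \<in> {0..R}" "r \<le> s" for n r s
  proof -
    have "delayed (\<epsilon> n) (d n) (w n) r - delayed (\<epsilon> n) (d n) (w n) s \<le> L * (s - r)"
      unfolding L_def using that by (intro delayed_diff_le w_cont \<epsilon> D w_le) auto
    moreover have "delayed (\<epsilon> n) (d n) (w n) s \<le> delayed (\<epsilon> n) (d n) (w n) r"
      using that by (intro delayed_antimono w_cont \<epsilon>) auto
    ultimately show ?thesis
      using that w_eq[of r n] w_eq[of s n] by simp
  qed
  have lip: "\<bar>w n r - w n s\<bar> \<le> L * \<bar>r - s\<bar>" if "r \<in> {0..R}" "s \<in> {0..R}" for n r s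
    using lip'[OF that, of n] lip'[OF that(2,1), of n] by (cases "r \<le> s") (auto simp: abs_minus_commute)
  have L: "0 \<le> L"
    by (simp add: L_def slope_bound_nonneg)
  have w0: "w n 0 = d n" for n
    using w_eq[of 0 n] R \<epsilon> by simp
  obtain u k where u: "continuous_on {0..R} u" and k: "strict_mono (k :: nat \<Rightarrow> nat)"
    and unif: "\<And>e. 0 < e \<Longrightarrow> \<exists>N. \<forall>n x. n \<ge> N \<and> x \<in> {0..R} \<longrightarrow> norm (w (k n) x - u x) < e"
  proof (rule Arzela_Ascoli[of "{0..R}" w "\<bar>\<delta>\<bar> + \<bar>D\<bar> + L * R"])
    show "norm (w n x) \<le> \<bar>\<delta>\<bar> + \<bar>D\<bar> + L * R" if "x \<in> {0..R}" for n x
    proof -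
      have "\<bar>w n x - d n\<bar> \<le> L * \<bar>x\<bar>"
        using lip[OF that, of 0 n] R w0 by simp
      also have "\<dots> \<le> L * R"
        using that L by (intro mult_left_mono) auto
      finally show ?thesis
        using d[of n] by auto
    qed
    show "\<exists>h>0. \<forall>n y. y \<in> {0..R} \<and> norm (x - y) < h \<longrightarrow> norm (w n x - w n y) < e"
      if x: "x \<in> {0..R}" and e: "0 < e" for x e
    \<comment> \<open>The summand 1 covers \<open>L = 0\<close> and makes the final inequality
      strict.\<close>
    proof (intro exI[of _ "e / (L + 1)"] conjI allI impI)
      show "0 < e / (L + 1)"
        using e L by simp
      fix n y assume y: "y \<in> {0..R} \<and> norm (x - y) < e / (L + 1)"
      have "norm (w n x - w n y) \<le> L * \<bar>x - y\<bar>"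
        using lip x y by simp
      also have "\<dots> \<le> L * (e / (L + 1))"
        using y L by (intro mult_left_mono) auto
      also have "\<dots> < e"
        using L e by (simp add: field_simps)
      finally show "norm (w n x - w n y) < e" .
    qed
  qed auto
  have lim: "(\<lambda>i. w (k i) r) \<longlonglongrightarrow> u r" if "r \<in> {0..R}" for r
    using unif that by (fastforce simp: LIMSEQ_def dist_norm)
  have d_lim: "(\<lambda>i. d (k i)) \<longlonglongrightarrow> u 0"
    using lim[of 0] R w0 by simp
  have mem: "u 0 \<in> {\<delta>..D}"
    using d by (intro closed_sequentially[OF closed_atLeastAtMost _ d_lim]) auto
  have eq: "u r = delayed 0 (u 0) u r" if r: "r \<in> {0..R}" for r
  proof -
    have "(\<lambda>i. \<epsilon> (k i)) \<longlonglongrightarrow> 0"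
    proof -
      have "(\<lambda>n. R / Suc n) \<longlonglongrightarrow> 0"
        by real_asymp
      from LIMSEQ_subseq_LIMSEQ[OF this strict_mono_o[OF j k]] show ?thesis
        by (simp add: o_def \<epsilon>_def)
    qed
    then have "(\<lambda>i. max 0 (r - \<epsilon> (k i))) \<longlonglongrightarrow> max 0 (r - 0)"
      by (intro tendsto_intros)
    moreover have "r - \<epsilon> (k i) \<le> R" for i
      using r \<epsilon>[of "k i"] by simp
    ultimately have "(\<lambda>i. integral {0..max 0 (r - \<epsilon> (k i))} (slope (w (k i)))) \<longlonglongrightarrow> integral {0..max 0 (r - 0)} (slope u)"
      using w_le r \<epsilon> lim by (intro tendsto_integral_slope[OF w_cont u]) auto
    then have "(\<lambda>i. d (k i) - integral {0..max 0 (r - \<epsilon> (k i))} (slope (w (k i)))) \<longlonglongrightarrow> u 0 - integral {0..r} (slope u)"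
      using d_lim r by (intro tendsto_intros) auto
    then have "(\<lambda>i. w (k i) r) \<longlonglongrightarrow> u 0 - integral {0..r} (slope u)"
      using w_eq[OF r] by (simp add: delayed_def)
    then show ?thesis
      using lim[OF r] LIMSEQ_unique r by (force simp: delayed_def)
  qed
  have "profile (u 0) u"
    unfolding profile_def using u eq by blast
  then show ?thesis
    by (rule that[OF k mem _ lim[unfolded w_def]])
qed

subsection \<open>Pohozaev energy of a profile\<close>

lemma profile_continuous: "profile D u \<Longrightarrow> continuous_on {0..R} u"
  by (simp add: profile_def)

lemma profile_0: "profile D u \<Longrightarrow> u 0 = D"
  using R by (simp add: profile_def)

lemma profile_antimono:
  assumes "profile D u" "0 \<le> r" "r \<le> s" "s \<le> R"
  shows "u s \<le> u r"
  using delayed_antimono[of u r s 0 D] assms by (simp add: profile_def)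

lemma profile_le: "profile D u \<Longrightarrow> r \<in> {0..R} \<Longrightarrow> u r \<le> D"
  using profile_antimono[of D u 0 r] profile_0[of D u] by simp

lemma profile_derivative_within:
  assumes u: "profile D u" and r: "r \<in> {0..R}"
  shows "(u has_real_derivative - slope u r) (at r within {0..R})"
proof -
  have "((\<lambda>x. integral {0..x} (slope u)) has_real_derivative slope u r) (at r within {0..R})"
    using continuous_on_slope[OF profile_continuous[OF u]] r by (intro integral_has_real_derivative)
  then have "((\<lambda>x. D - integral {0..x} (slope u)) has_real_derivative - slope u r) (at r within {0..R})"
    by (auto intro!: derivative_eq_intros)
  then show ?thesis
    using u r by (elim has_field_derivative_transform_within[OF _ zero_less_one r])
      (auto simp: profile_def delayed_def)
qed

lemma profile_derivative:
  assumes u: "profile D u" and r: "0 < r" "r < R"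
  shows "(u has_real_derivative - slope u r) (at r)"
  using profile_derivative_within[OF u, of r] at_within_Icc_at[OF r] r by simp

text \<open>The power of 2 comes from evaluating the weight at \<open>2 * t\<close> instead of
  \<open>t\<close>, the factor \<open>1 / cl\<close> from the lower bound of the
  coefficient.\<close>

definition drop_const :: real where "drop_const = 2 powr (\<theta> * q) / cl"

lemma drop_const_pos: "0 < drop_const"
  using cl by (simp add: drop_const_def)

text \<open>A profile that stays nonnegative up to \<^term>\<open>2 * t\<close> cannot drop by more than \<^term>\<open>u t\<close> on
  the interval from \<^term>\<open>t\<close> to \<^term>\<open>2 * t\<close>, which limits the flux at \<^term>\<open>t\<close>.\<close>

lemma mass_powr_le:
  assumes u: "profile D u" and nonneg: "0 \<le> u R" and t: "0 < t" "2 * t \<le> R"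
  shows "mass u t powr q \<le> drop_const * u t * t powr (\<theta> * q - 1)"
proof -
  define C where "C = cl * ((2 * t) powr (-\<theta>) * mass u t) powr q"
  note cont = profile_continuous[OF u]
  have "C \<le> slope u s" if s: "s \<in> {t..2 * t}" for s
  proof -
    have "(2 * t) powr (-\<theta>) * mass u t \<le> s powr (-\<theta>) * mass u s"
      using s t theta_pos mass_nonneg by (intro mult_mono mass_mono[OF cont] powr_mono2') auto
    then show ?thesis
      unfolding C_def slope_def using s t cl c_bounds[of s "max 0 (u s)"] q_pos mass_nonneg
      by (intro mult_mono[OF _ powr_mono2]) auto
  qed
  then have "integral {t..2 * t} (\<lambda>_. C) \<le> integral {t..2 * t} (slope u)"
    using t by (intro integral_le slope_integrable[OF cont]) auto
  also have "\<dots> = u t - u (2 * t)"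
    using delayed_diff[OF cont, of t "2 * t" 0 D] u t by (simp add: profile_def)
  also have "\<dots> \<le> u t"
    using profile_antimono[OF u, of "2 * t" R] nonneg t by simp
  finally have "t * C \<le> u t"
    using t by simp
  then have "drop_const * (t * C) * t powr (\<theta> * q - 1) \<le> drop_const * u t * t powr (\<theta> * q - 1)"
    using drop_const_pos by (intro mult_right_mono mult_left_mono) auto
  moreover have C: "C = cl * (2 powr (-\<theta> * q) * t powr (-\<theta> * q) * mass u t powr q)"
    using t mass_nonneg by (simp add: C_def powr_mult powr_powr)
  have "drop_const * (t * C) * t powr (\<theta> * q - 1) = mass u t powr q"
    unfolding C drop_const_def using t cl by (simp add: powr_minus powr_diff field_simps)
  ultimately show ?thesis
    by simp
qed

lemma slope_eq: "0 < r \<Longrightarrow> slope u r = c r (max 0 (u r)) * (r powr (-\<theta> * q) * mass u r powr q)"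
  using mass_nonneg by (simp add: slope_def powr_mult powr_powr)

text \<open>Inserting the bound on \<open>mass u t\<close> cancels all powers of \<open>t\<close>.
  The resulting scale-invariant gradient estimate has a constant independent of the height and later
  controls the effect of a varying coefficient on the energy.\<close>

lemma slope_le_quotient:
  assumes u: "profile D u" and nonneg: "0 \<le> u R" and t: "0 < t" "2 * t \<le> R"
  shows "t * slope u t \<le> cu * drop_const * u t"
proof -
  have "t * slope u t = c t (max 0 (u t)) * (t powr (1 - \<theta> * q) * mass u t powr q)"
    using t by (simp add: slope_eq powr_diff powr_minus field_simps)
  also have "\<dots> \<le> cu * (t powr (1 - \<theta> * q) * (drop_const * u t * t powr (\<theta> * q - 1)))"
    using c_bounds[of t "max 0 (u t)"] t cu mass_powr_le[OF assms]
    by (intro mult_mono mult_left_mono) auto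
  also have "\<dots> = cu * drop_const * u t"
    using t by (simp add: powr_diff field_simps)
  finally show ?thesis .
qed

lemma mass_pos:
  assumes u: "profile D u" and D: "0 < D" and r: "0 < r" "r \<le> R"
  shows "0 < mass u r"
proof -
  note cont = profile_continuous[OF u]
  obtain \<delta> where \<delta>: "0 < \<delta>" "\<And>x. x \<in> {0..R} \<Longrightarrow> dist x 0 < \<delta> \<Longrightarrow> dist (u x) (u 0) < D / 2"
    using cont[unfolded continuous_on_iff, rule_format, of 0 "D / 2"] R D by auto
  define s where "s = min r (\<delta> / 2)"
  have s: "0 < s" "s \<le> r" "dist s 0 < \<delta>"
    using r \<delta>(1) by (auto simp: s_def)
  then have "D / 2 \<le> u s"
    using \<delta>(2)[of s] r profile_0[OF u] by (simp add: dist_norm abs_if split: if_splits)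
  then have "(D / 2) powr p * s powr (\<mu> + 1) / (\<mu> + 1) \<le> mass u s"
    using s r D profile_antimono[OF u] by (intro mass_ge[OF cont]) (auto intro: order_trans)
  moreover have "0 < (D / 2) powr p * s powr (\<mu> + 1) / (\<mu> + 1)"
    using s D mu_pos by simp
  ultimately show ?thesis
    using mass_mono[OF cont s(2)] r by simp
qed

lemma slope_pos:
  assumes u: "profile D u" and D: "0 < D" and r: "0 < r" "r \<le> R"
  shows "0 < slope u r"
  unfolding slope_def using mass_pos[OF assms] r c_bounds[of r "max 0 (u r)"] cl
  by (intro mult_pos_pos) auto

lemma profile_strict_antimono:
  assumes u: "profile D u" and D: "0 < D" and r: "0 \<le> r" "r < s" "s \<le> R"
  shows "u s < u r"
  using r slope_pos[OF u D]
  by (intro DERIV_neg_imp_decreasing_open[OF r(2)] continuous_on_subset[OF profile_continuous[OF u]])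
    (force intro!: exI profile_derivative[OF u])+

text \<open>For \<open>c = c0\<close> the first summand is (m - 1) / m times
  \<open>r * mass u r * slope u r\<close>, so with \<open>\<tau> = pohozaev\<close> this is the
  classical Pohozaev functional, \<open>mass\<close> being the negative flux. The parameter
  \<open>\<tau>\<close> is left free for the perturbed coefficient.\<close>

definition energy :: "real \<Rightarrow> real \<Rightarrow> (real \<Rightarrow> real) \<Rightarrow> real \<Rightarrow> real" where
  "energy c0 \<tau> u r = c0 / (1 + q) * (mass u r powr (1 + q) * r powr (1 - \<theta> * q))
    + r powr (\<mu> + 1) * u r powr (p + 1) / (p + 1) - \<tau> * (mass u r * u r)"

definition pohozaev :: real where "pohozaev = (\<theta> + 1 - m) / m"

lemma pohozaev_pos: "0 < pohozaev"
  using theta m by (simp add: pohozaev_def)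

lemma pohozaev_eq: "1 - \<theta> * q = - pohozaev * (1 + q)"
  using m by (simp add: pohozaev_def q_def field_simps)

text \<open>If \<open>c r v = c0\<close> and \<open>\<tau> = pohozaev\<close>, all terms with
  \<open>g\<close> cancel and the Pohozaev identity remains. They are kept apart here to expose the
  ratio \<open>c0 / c r v\<close>.\<close>

lemma has_real_derivative_energy:
  assumes u: "profile D u" and r: "0 < r" "r < R" "0 < u r"
  defines "F \<equiv> mass u r" and "g \<equiv> slope u r" and "v \<equiv> u r"
  shows "(energy c0 \<tau> u has_real_derivative
      c0 / c r v * g * (r powr (\<mu> + 1) * v powr p - pohozaev * F)
      + (\<mu> + 1) / (p + 1) * (r powr \<mu> * v powr (p + 1)) - r powr (\<mu> + 1) * v powr p * g
      - \<tau> * (r powr \<mu> * v powr (p + 1) - F * g)) (at r)"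
proof -
  have F: "0 < F"
    unfolding F_def using mass_pos[OF u] profile_le[OF u, of r] r by simp
  have dF: "(mass u has_real_derivative r powr \<mu> * v powr p) (at r)"
    using has_real_derivative_mass[OF profile_continuous[OF u] r(1,2)] r by (simp add: v_def)
  have du: "(u has_real_derivative - g) (at r)"
    unfolding g_def using profile_derivative[OF u] r by simp
  have v: "0 < v"
    using r by (simp add: v_def)
  have ck: "0 < c r v"
    using c_bounds[of r v] cl r v by force
  have g: "g = c r v * (r powr (-\<theta> * q) * F powr q)"
    using r slope_eq[of r u] by (simp add: g_def F_def v_def)
  have 1: "((\<lambda>x. mass u x powr (1 + q)) has_real_derivative (1 + q) * F powr q * (r powr \<mu> * v powr p)) (at r)"
    using DERIV_fun_powr[OF dF, of "1 + q"] F by (simp add: F_def)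
  have 2: "((\<lambda>x. x powr (1 - \<theta> * q)) has_real_derivative (1 - \<theta> * q) * r powr (-\<theta> * q)) (at r)"
    using has_real_derivative_powr[OF r(1), of "1 - \<theta> * q"] by simp
  have 3: "((\<lambda>x. x powr (\<mu> + 1)) has_real_derivative (\<mu> + 1) * r powr \<mu>) (at r)"
    using has_real_derivative_powr[OF r(1), of "\<mu> + 1"] by simp
  have 4: "((\<lambda>x. u x powr (p + 1)) has_real_derivative - ((p + 1) * v powr p * g)) (at r)"
    using DERIV_fun_powr[OF du, of "p + 1"] v by (simp add: v_def)
  have "(energy c0 \<tau> u has_real_derivative
      c0 / (1 + q) * ((1 + q) * F powr q * (r powr \<mu> * v powr p) * r powr (1 - \<theta> * q)
        + (1 - \<theta> * q) * r powr (-\<theta> * q) * F powr (1 + q))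
      + ((\<mu> + 1) * r powr \<mu> * v powr (p + 1) + - ((p + 1) * v powr p * g) * r powr (\<mu> + 1)) / (p + 1)
      - \<tau> * (r powr \<mu> * v powr p * u r + - g * mass u r)) (at r)"
    unfolding energy_def F_def v_def
    by (intro DERIV_diff DERIV_add DERIV_cdivide DERIV_cmult DERIV_mult
        1[unfolded F_def v_def] 2 3 4[unfolded v_def] dF[unfolded v_def] du)
  moreover have "c0 / (1 + q) * ((1 + q) * F powr q * (r powr \<mu> * v powr p) * r powr (1 - \<theta> * q)
        + (1 - \<theta> * q) * r powr (-\<theta> * q) * F powr (1 + q))
      = c0 / c r v * g * (r powr (\<mu> + 1) * v powr p - pohozaev * F)"
  proof -
    have "c0 / (1 + q) * ((1 + q) * X) = c0 * X" for X
      using q_pos by simp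
    moreover have "(1 + q) * F powr q * (r powr \<mu> * v powr p) * r powr (1 - \<theta> * q)
        + (1 - \<theta> * q) * r powr (-\<theta> * q) * F powr (1 + q)
      = (1 + q) * (r powr (-\<theta> * q) * F powr q * (r powr (\<mu> + 1) * v powr p - pohozaev * F))"
    proof -
      have "r powr (1 - \<theta> * q) = r * r powr (-\<theta> * q)" "r powr (\<mu> + 1) = r * r powr \<mu>"
        "F powr (1 + q) = F * F powr q"
        using r F by (simp_all add: powr_add powr_diff powr_minus field_simps)
      then show ?thesis
        unfolding pohozaev_eq by (simp add: algebra_simps)
    qed
    ultimately show ?thesis
      using ck by (simp add: g)
  qed
  moreover have "((\<mu> + 1) * r powr \<mu> * v powr (p + 1) + - ((p + 1) * v powr p * g) * r powr (\<mu> + 1)) / (p + 1)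
      = (\<mu> + 1) / (p + 1) * (r powr \<mu> * v powr (p + 1)) - r powr (\<mu> + 1) * v powr p * g"
    using p_pos by (simp add: field_simps)
  moreover have "r powr \<mu> * v powr p * u r + - g * mass u r = r powr \<mu> * v powr (p + 1) - F * g"
    using v by (simp add: powr_add F_def v_def)
  ultimately show ?thesis
    by (simp add: add_diff_eq)
qed

section \<open>A priori bounds independent of the height\<close>

lemma energy_lower:
  assumes "0 \<le> c0" "0 < r" "0 \<le> u r"
  shows "- \<tau> * (mass u r * u r) \<le> energy c0 \<tau> u r"
  using assms q_pos p_pos by (simp add: energy_def)

lemma mass_le_const:
  assumes u: "profile D u" and nonneg: "0 \<le> u R" and t: "0 < t" "2 * t \<le> R" and K: "u t \<le> K" "0 \<le> K"
  shows "mass u t \<le> (drop_const * K) powr (m - 1) * R powr (\<theta> + 1 - m)"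
proof -
  have "mass u t powr q \<le> drop_const * u t * t powr (\<theta> * q - 1)"
    by (rule mass_powr_le[OF u nonneg t])
  also have "\<dots> \<le> drop_const * K * t powr (\<theta> * q - 1)"
    using K drop_const_pos by (intro mult_right_mono mult_left_mono) auto
  finally have "(mass u t powr q) powr (m - 1) \<le> (drop_const * K * t powr (\<theta> * q - 1)) powr (m - 1)"
    using m by (intro powr_mono2) auto
  moreover have "(mass u t powr q) powr (m - 1) = mass u t"
    using q_m mass_nonneg by (simp add: powr_powr)
  moreover have "(drop_const * K * t powr (\<theta> * q - 1)) powr (m - 1) = (drop_const * K) powr (m - 1) * t powr (\<theta> + 1 - m)"
  proof -
    have "(\<theta> * q - 1) * (m - 1) = \<theta> + 1 - m"
      using m by (simp add: q_def field_simps)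
    then show ?thesis
      using drop_const_pos K by (simp add: powr_mult powr_powr)
  qed
  moreover have "(drop_const * K) powr (m - 1) * t powr (\<theta> + 1 - m) \<le> (drop_const * K) powr (m - 1) * R powr (\<theta> + 1 - m)"
    using t theta by (intro mult_left_mono powr_mono2) auto
  ultimately show ?thesis
    by simp
qed

text \<open>One factor \<open>mass u t\<close> is bounded by a constant and the factor
  \<open>mass u t powr q\<close> by a power of \<open>t\<close> that cancels
  \<open>t powr (1 - \<theta> * q)\<close>. The result depends on \<open>u\<close> only through
  \<open>u t\<close>.\<close>

lemma energy_upper:
  assumes u: "profile D u" and nonneg: "0 \<le> u R" and t: "0 < t" "2 * t \<le> R" and c0: "0 \<le> c0" and \<tau>: "0 \<le> \<tau>"
  shows "energy c0 \<tau> u t \<le> c0 / (1 + q) * ((drop_const * u t) powr (m - 1) * R powr (\<theta> + 1 - m) * (drop_const * u t))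
    + R powr (\<mu> + 1) * u t powr (p + 1) / (p + 1)"
proof -
  have ut: "0 \<le> u t"
    using profile_antimono[OF u, of t R] t nonneg by simp
  have "mass u t powr (1 + q) * t powr (1 - \<theta> * q) = mass u t * (mass u t powr q * t powr (1 - \<theta> * q))"
    using mass_nonneg[of u t] by (cases "mass u t = 0") (simp_all add: powr_add)
  also have "\<dots> \<le> ((drop_const * u t) powr (m - 1) * R powr (\<theta> + 1 - m)) * (drop_const * u t * t powr (\<theta> * q - 1) * t powr (1 - \<theta> * q))"
    using mass_le_const[OF u nonneg t order_refl ut] mass_powr_le[OF u nonneg t] mass_nonneg
    by (intro mult_mono mult_right_mono) auto
  also have "drop_const * u t * t powr (\<theta> * q - 1) * t powr (1 - \<theta> * q) = drop_const * u t"
    using t by (simp add: powr_diff)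
  finally have "c0 / (1 + q) * (mass u t powr (1 + q) * t powr (1 - \<theta> * q))
      \<le> c0 / (1 + q) * ((drop_const * u t) powr (m - 1) * R powr (\<theta> + 1 - m) * (drop_const * u t))"
    using c0 q_pos by (intro mult_left_mono) auto
  moreover have "t powr (\<mu> + 1) * u t powr (p + 1) / (p + 1) \<le> R powr (\<mu> + 1) * u t powr (p + 1) / (p + 1)"
    using t mu_pos p_pos by (intro divide_right_mono mult_right_mono powr_mono2) auto
  moreover have "0 \<le> \<tau> * (mass u t * u t)"
    using \<tau> ut mass_nonneg by simp
  ultimately show ?thesis
    by (simp add: energy_def)
qed

text \<open>By monotonicity \<open>mass u t powr q\<close> is at least a multiple of
  \<open>u t powr (p * q)\<close>, while \<open>mass_powr_le\<close> makes it at most a multiple of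
  \<open>u t\<close>. As \<open>p * q > 1\<close>, this bounds \<open>u t\<close>, whatever the
  height.\<close>

lemma profile_bounded_at:
  assumes t: "0 < t" "2 * t \<le> R"
  obtains K where "0 < K" "\<And>D u. profile D u \<Longrightarrow> 0 \<le> u R \<Longrightarrow> u t < K"
proof -
  define X where "X = (t powr (\<mu> + 1) / (\<mu> + 1)) powr q"
  define Y where "Y = drop_const * t powr (\<theta> * q - 1)"
  have X: "0 < X" and Y: "0 < Y"
    using t mu_pos drop_const_pos by (simp_all add: X_def Y_def)
  define K where "K = (Y / X) powr (1 / (p * q - 1)) + 1"
  have K: "0 < K"
    unfolding K_def by (smt (verit) powr_ge_zero)
  have "u t < K" if u: "profile D u" and nonneg: "0 \<le> u R" for D u
  proof (cases "0 < u t")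
    case True
    have "u t powr p * t powr (\<mu> + 1) / (\<mu> + 1) \<le> mass u t"
      using t True profile_antimono[OF u] by (intro mass_ge profile_continuous[OF u]) auto
    then have "(u t powr p * t powr (\<mu> + 1) / (\<mu> + 1)) powr q \<le> mass u t powr q"
      using q_pos mu_pos by (intro powr_mono2) auto
    also have "\<dots> \<le> Y * u t"
      using mass_powr_le[OF u nonneg t] by (simp add: Y_def mult.commute mult.left_commute)
    also have "(u t powr p * t powr (\<mu> + 1) / (\<mu> + 1)) powr q = u t powr (p * q) * X"
      using True t mu_pos by (simp add: X_def powr_mult powr_divide powr_powr)
    finally have "u t powr (p * q - 1) \<le> Y / X"
      using True X by (simp add: powr_diff field_simps)
    then have "(u t powr (p * q - 1)) powr (1 / (p * q - 1)) \<le> (Y / X) powr (1 / (p * q - 1))"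
      using pq by (intro powr_mono2) auto
    then show ?thesis
      using True pq by (simp add: K_def powr_powr)
  qed (use K in auto)
  with K that show ?thesis
    by blast
qed

text \<open>Subcriticality enters through the sign of \<^term>\<open>\<kappa>\<close>. Near the origin the coefficient is almost
  the constant \<^term>\<open>c0\<close>, and the error term containing \<^term>\<open>mass u r * slope u r\<close> is absorbed by
  enlarging the coefficient of the last summand of the energy.\<close>

lemma energy_derivative_ge:
  assumes u: "profile D u" and nonneg: "0 \<le> u R" and r: "0 < r" "2 * r \<le> R" "0 < u r"
    and close: "\<bar>c0 / c r (u r) - 1\<bar> \<le> \<eta>"
  defines "\<kappa> \<equiv> (\<mu> + 1) / (p + 1) - pohozaev"
  obtains y where "(energy c0 ((1 + \<eta>) * pohozaev) u has_real_derivative y) (at r)"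
    "(\<kappa> - \<eta> * (cu * drop_const + pohozaev)) * (r powr \<mu> * u r powr (p + 1)) \<le> y"
proof -
  define F g v S where "F = mass u r" and "g = slope u r" and "v = u r" and "S = r powr \<mu> * v powr (p + 1)"
  define T where "T = r powr (\<mu> + 1) * v powr p * g"
  define x where "x = c0 / c r v - 1"
  have x: "\<bar>x\<bar> \<le> \<eta>"
    using close by (simp add: x_def v_def)
  have F: "0 \<le> F * g"
    using mass_nonneg slope_nonneg[of r u] r by (simp add: F_def g_def)
  have T: "0 \<le> T" "T \<le> cu * drop_const * S"
  proof -
    show "0 \<le> T"
      using slope_nonneg[of r u] r by (simp add: T_def g_def)
    have "T = r powr \<mu> * v powr p * (r * g)"
      using r by (simp add: T_def powr_add)
    also have "\<dots> \<le> r powr \<mu> * v powr p * (cu * drop_const * v)"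
      using slope_le_quotient[OF u nonneg r(1,2)] by (intro mult_left_mono) (auto simp: g_def v_def)
    also have "\<dots> = cu * drop_const * S"
      using r by (simp add: S_def v_def powr_add)
    finally show "T \<le> cu * drop_const * S" .
  qed
  have r2: "r < R"
    using r by simp
  note deriv = has_real_derivative_energy[OF u r(1) r2 r(3), of c0 "(1 + \<eta>) * pohozaev",
      folded F_def g_def v_def, folded S_def]
  have "- \<eta> * T \<le> x * T"
    using x T by (intro mult_right_mono) auto
  moreover have "\<eta> * T \<le> \<eta> * (cu * drop_const * S)"
    using x T by (intro mult_left_mono) auto
  moreover have "x * (pohozaev * (F * g)) \<le> \<eta> * (pohozaev * (F * g))"
    using x F pohozaev_pos by (intro mult_right_mono) auto
  moreover have "c0 / c r v * g * (r powr (\<mu> + 1) * v powr p - pohozaev * F) + (\<mu> + 1) / (p + 1) * S - r powr (\<mu> + 1) * v powr p * g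
      - (1 + \<eta>) * pohozaev * (S - F * g)
      = \<kappa> * S - \<eta> * pohozaev * S + x * T - x * (pohozaev * (F * g)) + \<eta> * (pohozaev * (F * g))"
    unfolding x_def T_def \<kappa>_def by (simp add: algebra_simps)
  ultimately have "(\<kappa> - \<eta> * (cu * drop_const + pohozaev)) * S
      \<le> c0 / c r v * g * (r powr (\<mu> + 1) * v powr p - pohozaev * F) + (\<mu> + 1) / (p + 1) * S - r powr (\<mu> + 1) * v powr p * g
      - (1 + \<eta>) * pohozaev * (S - F * g)"
    by (simp add: algebra_simps)
  then show ?thesis
    using that[OF deriv] by (simp add: S_def v_def)
qed

text \<open>The radius at which the drop allowed by \<open>slope_le\<close> for profiles of height
  \<open>D\<close> equals \<open>D / 2\<close>, that is, the root \<open>w\<close> of \<open>cu /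
  (\<mu> + 1) powr q * D powr (p * q) * w powr (1 + (\<mu> + 1 - \<theta>) * q) = D /
  2\<close>.\<close>

definition width :: "real \<Rightarrow> real" where
  "width D = ((\<mu> + 1) powr q / (2 * cu) * D powr (1 - p * q)) powr (1 / (1 + (\<mu> + 1 - \<theta>) * q))"

lemma width_pos: "0 < D \<Longrightarrow> 0 < width D"
  using cu mu_pos by (simp add: width_def)

lemma profile_ge_half:
  assumes u: "profile D u" and D: "0 < D" and r: "r \<in> {0..width D}" "width D \<le> R"
  shows "D / 2 \<le> u r"
proof -
  define e where "e = 1 + (\<mu> + 1 - \<theta>) * q"
  have e: "0 < e"
    unfolding e_def using mu q_pos by (simp add: add_pos_pos)
  define w where "w = width D"
  have w: "0 < w" "w \<le> R"
    using width_pos[OF D] r by (simp_all add: w_def)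
  define C where "C = cu * (w powr (\<mu> + 1 - \<theta>) * D powr p / (\<mu> + 1)) powr q"
  note cont = profile_continuous[OF u]
  have "u 0 - u w = integral {0..w} (slope u)"
    using delayed_diff[OF cont, of 0 w 0 D] u w by (simp add: profile_def)
  also have "\<dots> \<le> integral {0..w} (\<lambda>_. C)"
  proof (intro integral_le slope_integrable[OF cont])
    fix s assume s: "s \<in> {0..w}"
    have "slope u s \<le> cu * (s powr (\<mu> + 1 - \<theta>) * D powr p / (\<mu> + 1)) powr q"
      using s w D profile_le[OF u] by (intro slope_le[OF cont]) auto
    also have "\<dots> \<le> C"
      unfolding C_def using s cu q_pos mu mu_pos
      by (intro mult_left_mono powr_mono2[of q] divide_right_mono mult_right_mono powr_mono2[of "\<mu> + 1 - \<theta>"]) auto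
    finally show "slope u s \<le> C" .
  qed (use w in auto)
  also have "\<dots> = w * C"
    using w by simp
  also have "w * C = cu / (\<mu> + 1) powr q * D powr (p * q) * w powr e"
    using w D mu_pos by (simp add: C_def e_def powr_mult powr_divide powr_powr powr_add)
  also have "w powr e = (\<mu> + 1) powr q / (2 * cu) * D powr (1 - p * q)"
  proof -
    have "w powr e = (((\<mu> + 1) powr q / (2 * cu) * D powr (1 - p * q)) powr (1 / e)) powr e"
      by (simp add: w_def width_def e_def)
    also have "\<dots> = (\<mu> + 1) powr q / (2 * cu) * D powr (1 - p * q)"
      using e cu by (simp add: powr_powr)
    finally show ?thesis .
  qed
  also have "cu / (\<mu> + 1) powr q * D powr (p * q) * ((\<mu> + 1) powr q / (2 * cu) * D powr (1 - p * q)) = D / 2"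
    using D cu mu_pos by (simp add: powr_diff field_simps)
  finally have "D / 2 \<le> u w"
    using profile_0[OF u] by simp
  then show ?thesis
    using profile_antimono[OF u, of r w] r w by (simp add: w_def)
qed

subsection \<open>Shooting\<close>

text \<open>Since \<open>width D\<close> is a multiple of a negative power of \<open>D\<close>, the
  quantity on the right is a multiple of a power of \<open>D\<close>. Its exponent times
  \<open>e * (m - 1)\<close> is \<open>m * (\<mu> + 1) - (p + 1) * (\<theta> + 1 - m)\<close>,
  positive by subcriticality.\<close>

lemma large_height:
  assumes sub: "(p + 1) * (\<theta> + 1 - m) < m * (\<mu> + 1)" and L: "0 < L"
  shows "\<forall>\<^sub>F D in at_top. K < D \<and> width D \<le> R \<and> M < L * ((D / 2) powr (p + 1) * width D powr (\<mu> + 1))"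
proof -
  define e where "e = 1 + (\<mu> + 1 - \<theta>) * q"
  have e: "0 < e"
    unfolding e_def using mu q_pos by (simp add: add_pos_pos)
  define W where "W = ((\<mu> + 1) powr q / (2 * cu)) powr (1 / e)"
  have W: "0 < W"
    using cu mu_pos by (simp add: W_def)
  have width: "width D = W * D powr ((1 - p * q) / e)" for D
    unfolding width_def e_def[symmetric] W_def using cu
    by (simp add: powr_mult powr_powr del: times_divide_eq_left)
  have neg: "(1 - p * q) / e < 0"
    using pq e by (simp add: divide_neg_pos)
  have "0 < (p + 1) * e + (1 - p * q) * (\<mu> + 1)"
  proof -
    have 1: "e * (m - 1) = (m - 1) + (\<mu> + 1 - \<theta>) * (q * (m - 1))"
      unfolding e_def by (simp only: distrib_right mult_1_left mult.assoc)
    have 2: "(1 - p * q) * (m - 1) = (m - 1) - p * (q * (m - 1))"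
      by (simp only: left_diff_distrib mult_1_left mult.assoc)
    have "((p + 1) * e + (1 - p * q) * (\<mu> + 1)) * (m - 1)
        = (p + 1) * (e * (m - 1)) + (1 - p * q) * (m - 1) * (\<mu> + 1)"
      by (simp add: algebra_simps)
    also have "\<dots> = m * (\<mu> + 1) - (p + 1) * (\<theta> + 1 - m)"
      unfolding 1 2 q_m by (simp add: algebra_simps)
    finally have "0 < ((p + 1) * e + (1 - p * q) * (\<mu> + 1)) * (m - 1)"
      using sub by simp
    then show ?thesis
      using m by (simp add: zero_less_mult_iff)
  qed
  then have pos: "0 < p + 1 + (1 - p * q) / e * (\<mu> + 1)"
    using e by (simp add: field_simps)
  have "((\<lambda>D. W * D powr ((1 - p * q) / e)) \<longlongrightarrow> W * 0) at_top"
    using neg by (intro tendsto_intros tendsto_neg_powr filterlim_ident)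
  then have "\<forall>\<^sub>F D in at_top. width D < R"
    using R order_tendstoD(2)[of width 0 at_top R] by (simp add: width[abs_def])
  moreover have "\<forall>\<^sub>F D in at_top. M < L * ((D / 2) powr (p + 1) * width D powr (\<mu> + 1))"
  proof -
    define C where "C = L * (1 / 2) powr (p + 1) * W powr (\<mu> + 1)"
    have "0 < C"
      using L W by (simp add: C_def)
    then have "filterlim (\<lambda>D. C * D powr (p + 1 + (1 - p * q) / e * (\<mu> + 1))) at_top at_top"
      by (intro filterlim_tendsto_pos_mult_at_top[OF tendsto_const] real_powr_at_top pos)
    then have "\<forall>\<^sub>F D in at_top. M < C * D powr (p + 1 + (1 - p * q) / e * (\<mu> + 1))"
      by (simp add: filterlim_at_top_dense)
    then show ?thesis
      using eventually_gt_at_top[of 0]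
    proof eventually_elim
      case (elim D)
      have "(D / 2) powr (p + 1) = (1 / 2) powr (p + 1) * D powr (p + 1)"
        by (simp add: powr_divide)
      moreover have "width D powr (\<mu> + 1) = W powr (\<mu> + 1) * D powr ((1 - p * q) / e * (\<mu> + 1))"
        by (simp add: width powr_mult powr_powr)
      ultimately have "(D / 2) powr (p + 1) * width D powr (\<mu> + 1)
          = (1 / 2) powr (p + 1) * W powr (\<mu> + 1) * D powr (p + 1 + (1 - p * q) / e * (\<mu> + 1))"
        by (simp only: powr_add[of D "p + 1"] mult_ac)
      then show ?case
        using elim by (simp add: C_def mult.assoc)
    qed
  qed
  moreover have "\<forall>\<^sub>F D in at_top. K < D"
    by (rule eventually_gt_at_top)
  ultimately show ?thesis
    by eventually_elim auto
qed

text \<open>Two energy bounds are contradicted. The order of choices is essential: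
  \<open>\<eta>\<close> from \<open>\<kappa>\<close>, \<open>r0\<close> from continuity of the
  coefficient at 0, \<open>K\<close> from \<open>r0\<close>, \<open>M\<close> from \<open>K\<close>,
  and \<open>D\<close> last.\<close>

lemma large_profile_crosses:
  assumes sub: "(p + 1) * (\<theta> + 1 - m) < m * (\<mu> + 1)"
    and K0: "0 \<le> K0" "\<And>r s. r \<in> {0..R} \<Longrightarrow> K0 \<le> s \<Longrightarrow> c r s = c r K0"
  obtains D where "0 < D" "\<And>u. profile D u \<Longrightarrow> u R < 0"
proof -
  define \<kappa> where "\<kappa> = (\<mu> + 1) / (p + 1) - pohozaev"
  have "pohozaev < (\<mu> + 1) / (p + 1)"
    using sub p_pos m by (simp add: pohozaev_def pos_divide_less_eq pos_less_divide_eq mult.commute)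
  then have \<kappa>: "0 < \<kappa>"
    by (simp add: \<kappa>_def)
  define B where "B = cu * drop_const + pohozaev"
  have B: "0 < B"
    using cu drop_const_pos pohozaev_pos by (simp add: B_def add_pos_pos)
  \<comment> \<open>The coefficient error is allowed to consume half of
    \<open>\<kappa>\<close>.\<close>
  define \<eta> where "\<eta> = \<kappa> / (2 * B)"
  have \<eta>: "0 < \<eta>" "\<kappa> - \<eta> * B = \<kappa> / 2"
    using \<kappa> B by (simp_all add: \<eta>_def)
  define c0 where "c0 = c 0 K0"
  have c_pos: "0 < c r K0" if "r \<in> {0..R}" for r
    using c_bounds[OF that K0(1)] cl by linarith
  have c0: "0 < c0"
    using c_pos[of 0] R by (simp add: c0_def)
  have "continuous_on {0..R} (\<lambda>r. (\<lambda>(r, s). c r s) (r, K0))"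
    using K0 by (intro continuous_on_compose2[OF c_cont] continuous_intros) auto
  then have "continuous_on {0..R} (\<lambda>r. c0 / c r K0)"
    using c_pos by (intro continuous_intros) force+
  then obtain \<delta> where \<delta>: "0 < \<delta>"
    "\<And>r. r \<in> {0..R} \<Longrightarrow> dist r 0 < \<delta> \<Longrightarrow> dist (c0 / c r K0) (c0 / c 0 K0) < \<eta>"
    using \<eta> R unfolding continuous_on_iff by fastforce
  define r0 where "r0 = min (R / 2) (\<delta> / 2)"
  have r0: "0 < r0" "2 * r0 \<le> R" "r0 < \<delta>"
    using R \<delta>(1) by (auto simp: r0_def)
  obtain K1 where K1: "0 < K1" "\<And>D u. profile D u \<Longrightarrow> 0 \<le> u R \<Longrightarrow> u r0 < K1"
    using profile_bounded_at[OF r0(1,2)] by blast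
  \<comment> \<open>\<open>K1\<close> forces the level \<open>K\<close> to be reached before
    \<open>r0\<close>; \<open>K0\<close> makes the coefficient independent of \<open>u\<close> above
    that level.\<close>
  define K where "K = max K1 K0"
  have K: "0 < K" "K0 \<le> K"
    using K1 by (auto simp: K_def)
  define M where "M = c0 / (1 + q) * ((drop_const * K) powr (m - 1) * R powr (\<theta> + 1 - m) * (drop_const * K))
      + R powr (\<mu> + 1) * K powr (p + 1) / (p + 1)"
  define \<tau> where "\<tau> = (1 + \<eta>) * pohozaev"
  have \<tau>: "0 \<le> \<tau>"
    using \<eta> pohozaev_pos by (simp add: \<tau>_def)
  have "0 < \<kappa> / 2 / (\<mu> + 1)"
    using \<kappa> mu_pos by simp
  from eventually_happens'[OF _ large_height[OF sub this, of "2 * K" M]]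
  obtain D where D: "2 * K < D" and w_le: "width D \<le> R"
    and big: "M < \<kappa> / 2 / (\<mu> + 1) * ((D / 2) powr (p + 1) * width D powr (\<mu> + 1))"
    by (auto simp: trivial_limit_at_top_linorder)
  define L where "L = \<kappa> / 2 * (D / 2) powr (p + 1)"
  have D0: "0 < D"
    using D K by simp
  define w where "w = width D"
  have w: "0 < w" "w \<le> R"
    using width_pos[OF D0] w_le by (simp_all add: w_def)
  have "u R < 0" if u: "profile D u" for u
  proof (rule ccontr)
    assume "\<not> u R < 0"
    then have nonneg: "0 \<le> u R"
      by simp
    note cont = profile_continuous[OF u]
    have "u r0 \<le> K"
      using K1(2)[OF u nonneg] by (simp add: K_def)
    moreover have "K \<le> u 0"
      using D K profile_0[OF u] by simp
    ultimately obtain r1 where r1: "0 \<le> r1" "r1 \<le> r0" "u r1 = K"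
      using IVT2'[of u r0 K 0] r0 continuous_on_subset[OF cont, of "{0..r0}"] by auto
    have w_r1: "w < r1"
    proof (rule ccontr)
      assume "\<not> w < r1"
      then have "D / 2 \<le> K"
        using profile_ge_half[OF u D0, of r1] r1 w by (simp add: w_def)
      then show False
        using D by simp
    qed
    have deriv: "\<exists>y. (energy c0 \<tau> u has_real_derivative y) (at r) \<and> \<kappa> / 2 * (r powr \<mu> * u r powr (p + 1)) \<le> y"
      if r: "0 < r" "r \<le> r1" for r
    proof -
      have ur: "K \<le> u r"
        using profile_antimono[OF u, of r r1] r r1 r0 by simp
      have "c r (u r) = c r K0"
        using ur K r r1 r0 by (intro K0(2)) auto
      moreover have "c0 / c 0 K0 = 1"
        using c0 by (simp add: c0_def)
      ultimately have "\<bar>c0 / c r (u r) - 1\<bar> \<le> \<eta>"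
        using \<delta>(2)[of r] r r1 r0 by (simp add: dist_norm)
      then obtain y where "(energy c0 \<tau> u has_real_derivative y) (at r)"
        "(\<kappa> - \<eta> * B) * (r powr \<mu> * u r powr (p + 1)) \<le> y"
        using energy_derivative_ge[OF u nonneg, of r c0 \<eta>] r r1 r0 ur K
        unfolding \<kappa>_def B_def \<tau>_def by auto
      then show ?thesis
        using \<eta>(2) by auto
    qed
    \<comment> \<open>Beyond \<open>w\<close> mere monotonicity suffices; the quantitative gain
      comes from \<open>{0<..w}\<close>, where \<open>u\<close> is at least
      \<open>D / 2\<close>.\<close>
    have "energy c0 \<tau> u w \<le> energy c0 \<tau> u r1"
    proof (rule DERIV_nonneg_imp_nondecreasing[of w r1 "energy c0 \<tau> u"])
      fix r assume r: "w \<le> r" "r \<le> r1"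
      have "0 \<le> \<kappa> / 2 * (r powr \<mu> * u r powr (p + 1))"
        using \<kappa> by simp
      then show "\<exists>y. (energy c0 \<tau> u has_real_derivative y) (at r) \<and> 0 \<le> y"
        using deriv[of r] r w by (meson order_trans less_le_trans)
    qed (use w_r1 in simp)
    also have "\<dots> \<le> M"
      using energy_upper[OF u nonneg _ _ less_imp_le[OF c0] \<tau>, of r1] r1 r0 w w_r1 by (simp add: M_def)
    finally have "energy c0 \<tau> u w \<le> M" .
    \<comment> \<open>The power \<open>r powr (1 - \<theta> * q)\<close> in the energy is singular
      at 0, so the comparison starts at \<open>s > 0\<close> and \<open>s\<close> tends to 0.
      \<open>C\<close> collects the bound for \<open>\<tau> * (mass u s * u s)\<close> and the
      subtracted term with \<open>L\<close>.\<close>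
    moreover define C where "C = (\<tau> * D powr p * D + L) / (\<mu> + 1)"
    have "0 \<le> energy c0 \<tau> u w - L * (w powr (\<mu> + 1) / (\<mu> + 1))"
    proof (rule tendsto_upperbound[where f = "\<lambda>s. - C * s powr (\<mu> + 1)" and F = "at_right 0"])
      have "((\<lambda>s. - C * s powr (\<mu> + 1)) \<longlongrightarrow> - C * 0 powr (\<mu> + 1)) (at_right 0)"
        using mu_pos by (intro tendsto_intros tendsto_powr') (auto simp: eventually_at_filter)
      then show "((\<lambda>s. - C * s powr (\<mu> + 1)) \<longlongrightarrow> 0) (at_right 0)"
        by simp
      have "- C * s powr (\<mu> + 1) \<le> energy c0 \<tau> u w - L * (w powr (\<mu> + 1) / (\<mu> + 1))" if s: "0 < s" "s < w" for s
      proof -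
        have "energy c0 \<tau> u s - L * (s powr (\<mu> + 1) / (\<mu> + 1)) \<le> energy c0 \<tau> u w - L * (w powr (\<mu> + 1) / (\<mu> + 1))"
        proof (rule DERIV_nonneg_imp_nondecreasing[of s w "\<lambda>r. energy c0 \<tau> u r - L * (r powr (\<mu> + 1) / (\<mu> + 1))"])
          fix r assume r: "s \<le> r" "r \<le> w"
          obtain y where y: "(energy c0 \<tau> u has_real_derivative y) (at r)"
            "\<kappa> / 2 * (r powr \<mu> * u r powr (p + 1)) \<le> y"
            using deriv[of r] r s w_r1 by auto
          have "(D / 2) powr (p + 1) \<le> u r powr (p + 1)"
            using profile_ge_half[OF u D0, of r] r s w D0 p_pos by (intro powr_mono2) (auto simp: w_def)
          then have "\<kappa> / 2 * (r powr \<mu> * (D / 2) powr (p + 1)) \<le> \<kappa> / 2 * (r powr \<mu> * u r powr (p + 1))"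
            using \<kappa> by (intro mult_left_mono) auto
          then have "0 \<le> y - L * r powr \<mu>"
            using y(2) by (simp add: L_def algebra_simps)
          moreover have "((\<lambda>r. r powr (\<mu> + 1)) has_real_derivative (\<mu> + 1) * r powr \<mu>) (at r)"
            using has_real_derivative_powr[of r "\<mu> + 1"] r s by simp
          then have "((\<lambda>r. energy c0 \<tau> u r - L * (r powr (\<mu> + 1) / (\<mu> + 1))) has_real_derivative
              y - L * ((\<mu> + 1) * r powr \<mu> / (\<mu> + 1))) (at r)"
            by (intro DERIV_diff DERIV_cmult DERIV_cdivide y)
          ultimately show "\<exists>y. ((\<lambda>r. energy c0 \<tau> u r - L * (r powr (\<mu> + 1) / (\<mu> + 1))) has_real_derivative y) (at r) \<and> 0 \<le> y"
            using mu_pos by auto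
        qed (use s in simp)
        moreover have "- \<tau> * (mass u s * u s) \<le> energy c0 \<tau> u s"
          using s w c0 nonneg profile_antimono[OF u, of s R] by (intro energy_lower) auto
        moreover have "\<tau> * (mass u s * u s) \<le> \<tau> * (D powr p * s powr (\<mu> + 1) / (\<mu> + 1) * D)"
          using s w \<tau> D0 nonneg profile_antimono[OF u, of s R] profile_le[OF u] mass_nonneg mu_pos
          by (intro mult_left_mono mult_mono mass_le[OF cont]) auto
        moreover have "- C * s powr (\<mu> + 1)
            = - \<tau> * (D powr p * s powr (\<mu> + 1) / (\<mu> + 1) * D) - L * (s powr (\<mu> + 1) / (\<mu> + 1))"
          by (simp add: C_def add_divide_distrib algebra_simps)
        ultimately show ?thesis
          by linarith
      qed
      then show "\<forall>\<^sub>F s in at_right 0. - C * s powr (\<mu> + 1) \<le> energy c0 \<tau> u w - L * (w powr (\<mu> + 1) / (\<mu> + 1))"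
        using eventually_at_right_less eventually_at_right_real[OF w(1)]
        by (auto elim!: eventually_mono)
    qed simp
    moreover have "L * (w powr (\<mu> + 1) / (\<mu> + 1)) = \<kappa> / 2 / (\<mu> + 1) * ((D / 2) powr (p + 1) * width D powr (\<mu> + 1))"
      by (simp add: L_def w_def)
    ultimately show False
      using big by linarith
  qed
  then show ?thesis
    using that D0 by blast
qed

text \<open>The bound for the total drop over \<open>{0..R}\<close> scales like
  \<open>\<delta> powr (p * q)\<close> with \<open>p * q > 1\<close>, so for small
  \<open>\<delta>\<close> at most half of the height is lost, uniformly in the delay.\<close>

lemma small_height:
  assumes "0 < D"
  obtains \<delta> where "0 < \<delta>" "\<delta> \<le> D" "\<And>n. 0 < tonelli n \<delta> R"
proof -
  define C where "C = cu * (R powr (\<mu> + 1 - \<theta>) / (\<mu> + 1)) powr q * R"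
  have C: "0 < C"
    using cu R mu_pos by (simp add: C_def)
  \<comment> \<open>The second entry solves
    \<open>C * \<delta> powr (p * q - 1) = 1 / 2\<close>.\<close>
  define \<delta> where "\<delta> = min D ((1 / (2 * C)) powr (1 / (p * q - 1)))"
  have \<delta>: "0 < \<delta>"
    using assms C by (simp add: \<delta>_def)
  have "\<delta> powr (p * q - 1) \<le> ((1 / (2 * C)) powr (1 / (p * q - 1))) powr (p * q - 1)"
    using \<delta> pq by (intro powr_mono2) (auto simp: \<delta>_def)
  also have "\<dots> = 1 / (2 * C)"
    using C pq by (simp add: powr_powr)
  finally have le: "C * \<delta> powr (p * q - 1) \<le> 1 / 2"
    using C by (simp add: field_simps)
  have "slope_bound \<delta> * R = C * \<delta> powr (p * q)"
    using \<delta> R mu_pos by (simp add: slope_bound_def C_def powr_mult powr_divide powr_powr)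
  also have "\<dots> = (C * \<delta> powr (p * q - 1)) * \<delta>"
    using \<delta> by (simp add: powr_diff)
  also have "\<dots> \<le> 1 / 2 * \<delta>"
    using le \<delta> by (intro mult_right_mono) auto
  finally have small: "slope_bound \<delta> * R \<le> \<delta> / 2"
    by simp
  have pos: "0 < tonelli n \<delta> R" for n
  proof -
    have "delayed (R / Suc n) \<delta> (tonelli n \<delta>) 0 - delayed (R / Suc n) \<delta> (tonelli n \<delta>) R \<le> slope_bound \<delta> * (R - 0)"
      using R \<delta> iterate_le
      by (intro delayed_diff_le continuous_on_tonelli) (auto simp: tonelli_def simp del: iterate.simps)
    then show ?thesis
      using small \<delta> R tonelli_fixed[of R n \<delta>] by simp
  qed
  have "\<delta> \<le> D"
    by (simp add: \<delta>_def)
  then show ?thesis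
    using that \<delta> pos by blast
qed

text \<open>Compactness is used twice: first with the height fixed at \<open>D\<close>, to transfer
  the negative sign at \<open>R\<close> from profiles to delayed solutions, then for heights whose
  delayed solutions vanish at \<open>R\<close>.\<close>

theorem exists_profile:
  assumes sub: "(p + 1) * (\<theta> + 1 - m) < m * (\<mu> + 1)"
    and K0: "0 \<le> K0" "\<And>r s. r \<in> {0..R} \<Longrightarrow> K0 \<le> s \<Longrightarrow> c r s = c r K0"
  obtains d u where "0 < d" "profile d u" "u R = 0"
proof -
  obtain D where D: "0 < D" "\<And>u. profile D u \<Longrightarrow> u R < 0"
    using large_profile_crosses[OF assms] by blast
  obtain \<delta> where \<delta>: "0 < \<delta>" "\<delta> \<le> D" "\<And>n. 0 < tonelli n \<delta> R"
    using small_height[OF D(1)] by blast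
  obtain u k d' where k: "strict_mono (k :: nat \<Rightarrow> nat)" and d': "d' \<in> {D..D}" "profile d' u"
    and lim: "\<And>r. r \<in> {0..R} \<Longrightarrow> (\<lambda>i. tonelli (k i) D r) \<longlonglongrightarrow> u r"
    using tonelli_compactness[of "\<lambda>n. n" "\<lambda>_. D" D D, OF strict_mono_id[unfolded id_def] _ less_imp_le[OF D(1)]]
    by (metis atLeastAtMost_singleton insertI1)
  have "u R < 0"
    using D(2) d' by simp
  then have "\<forall>\<^sub>F i in sequentially. tonelli (k i) D R < 0"
    using order_tendstoD(2)[OF lim] R by simp
  then obtain i0 where i0: "\<And>i. i0 \<le> i \<Longrightarrow> tonelli (k i) D R < 0"
    by (auto simp: eventually_sequentially)
  \<comment> \<open>The shift discards the delays for which the sign at height \<open>D\<close> is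
    not yet known; for the others the intermediate value theorem in the height applies.\<close>
  define j where "j i = k (i + i0)" for i
  have j: "strict_mono j"
    using k by (simp add: strict_mono_def j_def)
  have "\<exists>d. d \<in> {\<delta>..D} \<and> tonelli (j i) d R = 0" for i
    using IVT2'[of "\<lambda>d. tonelli (j i) d R" D 0 \<delta>] i0[of "i + i0"] \<delta> continuous_on_tonelli_height
    by (force simp: j_def less_imp_le)
  then obtain d where d: "\<And>i. d i \<in> {\<delta>..D}" "\<And>i. tonelli (j i) (d i) R = 0"
    by metis
  obtain v l e where "strict_mono (l :: nat \<Rightarrow> nat)" and e: "e \<in> {\<delta>..D}" "profile e v"
    and v: "\<And>r. r \<in> {0..R} \<Longrightarrow> (\<lambda>i. tonelli (j (l i)) (d (l i)) r) \<longlonglongrightarrow> v r"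
    by (rule tonelli_compactness[where d = d, OF j d(1) less_imp_le[OF D(1)]]) (rule that)
  have "v R = 0"
    using v[of R] R by (simp add: d LIMSEQ_const_iff)
  then show ?thesis
    using that[of e v] e \<delta>(1) by simp
qed

end

section \<open>From profiles back to the boundary value problem\<close>

theorem theorem6p1:
  fixes N :: nat and R m p \<gamma> \<alpha> \<beta> c1 c2 :: real
    and g a :: "real \<Rightarrow> real"
  assumes "N \<ge> 1" and "R > 0" and "m > 1" and "real N > m" and "p > 1"
    and "0 < \<gamma>" and "\<gamma> < m - 1"
    and "real N + \<alpha> - m > 0" and "\<beta> - \<alpha> + 1 > 0"
    and "m - 1 < p" and "p < m * (real N + \<beta>) / (real N + \<alpha> - m) - 1"
    and "continuous_on {0..} g" and "\<forall>s\<ge>0. g s \<ge> 0" and "mono_on {0..} g"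
    and "((\<lambda>s. g s / s) \<longlongrightarrow> 1) at_top"
    and "continuous_on {0..} a" and "0 < c1" and "c1 \<le> c2"
    and "\<forall>r\<ge>0. c1 \<le> a r \<and> a r \<le> c2"
  shows "\<forall>k::nat. \<exists>v. positive_solution N \<alpha> \<beta> m p \<gamma> a (\<lambda>s. g (min (real k) s)) R v"
proof
  fix k :: nat
  define h where "h = (\<lambda>s. g (min (real k) s))"
  define \<theta> \<mu> where "\<theta> = real N + \<alpha> - 1" and "\<mu> = real N + \<beta> - 1"
  \<comment> \<open>The factor \<open>(a r + h s) powr \<gamma>\<close> acquires the exponent 1 / (m
    - 1) when the flux is solved for the derivative.\<close>
  define c where "c r s = (a r + h s) powr (\<gamma> / (m - 1))" for r s
  have h_bounds: "0 \<le> h s \<and> h s \<le> g k" if "0 \<le> s" for s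
    using that assms(13) mono_onD[OF assms(14), of "min (real k) s" "real k"] by (auto simp: h_def)
  have h_cont: "continuous_on {0..} h"
    unfolding h_def by (intro continuous_on_compose2[OF assms(12)] continuous_intros) auto
  have base: "c1 \<le> a r + h s \<and> a r + h s \<le> c2 + g k" if "0 \<le> r" "0 \<le> s" for r s
    using assms(19) h_bounds[OF that(2)] that by (auto intro: add_mono add_increasing2)
  interpret radial_flow m p \<theta> \<mu> R "c1 powr (\<gamma> / (m - 1))" "(c2 + g k) powr (\<gamma> / (m - 1))" c
  proof
    have "continuous_on ({0..R} \<times> {0..}) (\<lambda>x. (a (fst x) + h (snd x)) powr (\<gamma> / (m - 1)))"
      using assms(3,6,17) base
      by (intro continuous_on_powr' continuous_intros continuous_on_compose2[OF assms(16)]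
          continuous_on_compose2[OF h_cont]) (force intro: order_trans[of 0 c1])+
    then show "continuous_on ({0..R} \<times> {0..}) (\<lambda>(r, s). c r s)"
      by (simp add: c_def case_prod_unfold)
    show "c1 powr (\<gamma> / (m - 1)) \<le> c r s \<and> c r s \<le> (c2 + g k) powr (\<gamma> / (m - 1))"
      if "r \<in> {0..R}" "0 \<le> s" for r s
      unfolding c_def using base[of r s] that assms(3,6,17) by (intro conjI powr_mono2) auto
  qed (use assms in \<open>auto simp: \<theta>_def \<mu>_def\<close>)
  have "(p + 1) * (\<theta> + 1 - m) < m * (\<mu> + 1)"
    using assms(8,11) by (simp add: \<theta>_def \<mu>_def less_diff_eq pos_less_divide_eq)
  \<comment> \<open>\<open>K0 = k\<close> is admissible because truncation makes \<open>h\<close>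
    constant from \<open>k\<close> on.\<close>
  then obtain d u where d: "0 < d" and u: "profile d u" and uR: "u R = 0"
    by (rule exists_profile[of "real k"]) (auto simp: c_def h_def min_def)
  have cont: "continuous_on {0..R} u"
    by (rule profile_continuous[OF u])
  have pos: "0 < u r" if "r \<in> {0..<R}" for r
    using profile_strict_antimono[OF u d, of r R] that uR by simp
  \<comment> \<open>Raising the slope to the power \<open>m - 1\<close> undoes the exponent
    \<open>q\<close>; the coefficient then cancels the denominator and the weight cancels
    \<open>r powr (-\<theta>)\<close>.\<close>
  have flux: "flux N \<alpha> m \<gamma> a h u (\<lambda>r. - slope u r) r = - mass u r" if r: "r \<in> {0<..<R}" for r
  proof -
    define b where "b = a r + h (u r)"
    have b: "0 < b"
      using base[of r "u r"] r pos[of r] assms(17) by (simp add: b_def)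
    have F: "0 < mass u r"
      using mass_pos[OF u d] r by simp
    have g: "0 < slope u r"
      using slope_pos[OF u d] r by simp
    have "slope u r powr (m - 2) * slope u r = slope u r powr (m - 1)"
      using g powr_add[of "slope u r" "m - 2" 1] by simp
    also have "\<dots> = b powr \<gamma> * (r powr (-\<theta>) * mass u r)"
    proof -
      have "slope u r = b powr (\<gamma> / (m - 1)) * (r powr (-\<theta>) * mass u r) powr q"
        using r pos[of r] by (simp add: slope_def c_def b_def max_def)
      then show ?thesis
        using F r assms(3) by (simp add: powr_mult powr_powr q_m mult.assoc)
    qed
    finally have "slope u r powr (m - 2) * slope u r = b powr \<gamma> * (r powr (-\<theta>) * mass u r)" .
    then have "r powr \<theta> * (slope u r powr (m - 2) * slope u r) = b powr \<gamma> * mass u r"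
      using r by (simp add: powr_minus field_simps)
    then show ?thesis
      using b g unfolding flux_def b_def[symmetric] by (simp add: \<theta>_def mult.assoc)
  qed
  have F: "\<exists>F'. (\<forall>r\<in>{0<..<R}. (flux N \<alpha> m \<gamma> a h u (\<lambda>r. - slope u r) has_real_derivative F' r) (at r)) \<and>
      continuous_on {0<..<R} F' \<and> (\<forall>r\<in>{0<..<R}. - F' r = r powr (real N + \<beta> - 1) * u r powr p)"
  \<comment> \<open>Positivity of \<open>u\<close> before \<open>R\<close> removes the cutoff in
    \<open>mass\<close>, so the derivative of the flux is the original nonlinearity.\<close>
  proof (intro exI[of _ "\<lambda>r. - (r powr \<mu> * u r powr p)"] conjI ballI)
    fix r assume r: "r \<in> {0<..<R}"
    have "((\<lambda>r. - mass u r) has_real_derivative - (r powr \<mu> * u r powr p)) (at r)"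
      using DERIV_minus[OF has_real_derivative_mass[OF cont, of r]] r pos[of r] by (simp add: max_def)
    then show "(flux N \<alpha> m \<gamma> a h u (\<lambda>r. - slope u r) has_real_derivative - (r powr \<mu> * u r powr p)) (at r)"
      using flux by (elim has_field_derivative_transform_within_open[OF _ open_greaterThanLessThan r]) auto
    show "- (- (r powr \<mu> * u r powr p)) = r powr (real N + \<beta> - 1) * u r powr p"
      by (simp add: \<mu>_def)
  next
    have "continuous_on {0<..<R} u"
      by (rule continuous_on_subset[OF cont]) auto
    moreover have "\<forall>r\<in>{0<..<R}. u r \<noteq> 0"
      using pos by (auto simp: less_le)
    ultimately show "continuous_on {0<..<R} (\<lambda>r. - (r powr \<mu> * u r powr p))"
      by (auto intro!: continuous_intros)
  qed
  have du: "(u has_real_derivative - slope u r) (at r within {0..<R})" if "r \<in> {0..<R}" for r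
    using that by (intro DERIV_subset[OF profile_derivative_within[OF u]]) auto
  have v': "continuous_on {0..<R} (\<lambda>r. - slope u r)"
    by (intro continuous_on_minus continuous_on_subset[OF continuous_on_slope[OF cont]]) auto
  have v'0: "- slope u 0 = 0"
    by (simp add: slope_def)
  have "positive_solution N \<alpha> \<beta> m p \<gamma> a h R u"
    unfolding positive_solution_def
  proof (intro conjI, goal_cases)
    case 4
    show ?case
      by (rule exI[of _ "\<lambda>r. - slope u r"]) (use F du v' v'0 in blast)
  qed (use pos cont uR in auto)
  then show "\<exists>v. positive_solution N \<alpha> \<beta> m p \<gamma> a (\<lambda>s. g (min (real k) s)) R v"
    unfolding h_def by blast
qed

end
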